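(* Let $k\geq 2$ and let $\Delta$ be a neighborly simplicial $(2k-1)$-sphere with $n\geq 2k+2$ vertices. If $\Delta$ has a vertex $v$ such that $m_k(\mathrm{lk}(v,\Delta))\neq \binom{n-k-3}{k-1}$, then $\Delta$ is not polytopal.
   Context: A simplicial $(d-1)$-sphere is a simplicial complex whose geometric realization is homeomorphic to the $(d-1)$-dimensional sphere. A simplicial complex is $i$-neighborly if every $i$-subset of its vertices is a face; a simplicial $(d-1)$-sphere is neighborly if it is $\lfloor d/2\rfloor$-neighborly (so a $(2k-1)$-sphere is neighborly if it is $k$-neighborly). The link of a vertex $v$ is $\mathrm{lk}(v,\Delta)=\{\sigma\in\Delta: \sigma\cup\{v\}\in\Delta,\ v\notin\sigma\}$. A missing $i$-face of a complex is a set of $i+1$ of its vertices that is not a face but all of whose proper subsets are faces; $m_i$ denotes the number of missing $i$-faces. A simplicial sphere is polytopal if it is (isomorphic to) the boundary complex of a simplicial polytope, i.e., the complex of vertex sets of the proper faces of the polytope. *)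

theory Defs
  imports "HOL-Analysis.Analysis"
begin

text \<open>
  Complexes here are abstract: finite downward closed families of finite vertex sets.
  (\<open>simplicial_complex\<close> from the library is the geometric notion.)
\<close>

definition abstract_complex :: "'a set set \<Rightarrow> bool" where
  "abstract_complex \<Delta> \<longleftrightarrow>
     finite \<Delta> \<and> (\<forall>\<sigma>\<in>\<Delta>. finite \<sigma>) \<and> (\<forall>\<sigma>\<in>\<Delta>. \<forall>\<tau>. \<tau> \<subseteq> \<sigma> \<longrightarrow> \<tau> \<in> \<Delta>)"

definition vertex_set :: "'a set set \<Rightarrow> 'a set" where
  "vertex_set \<Delta> = {v. {v} \<in> \<Delta>}"

text \<open>
  The geometric realization, in barycentric coordinates: a point is a convex combination of
  vertices whose support is a face. The topology is that of the finite-dimensional real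
  coordinate space indexed by the vertices.
\<close>

definition geometric_realization :: "'a set set \<Rightarrow> ('a \<Rightarrow> real) topology" where
  "geometric_realization \<Delta> =
     subtopology (powertop_real (vertex_set \<Delta>))
       {x. (\<forall>v\<in>vertex_set \<Delta>. 0 \<le> x v) \<and> (\<Sum>v\<in>vertex_set \<Delta>. x v) = 1 \<and>
           {v \<in> vertex_set \<Delta>. x v \<noteq> 0} \<in> \<Delta>}"

definition simplicial_sphere :: "nat \<Rightarrow> 'a set set \<Rightarrow> bool" where
  "simplicial_sphere m \<Delta> \<longleftrightarrow>
     abstract_complex \<Delta> \<and> geometric_realization \<Delta> homeomorphic_space nsphere m"

definition neighborly :: "nat \<Rightarrow> 'a set set \<Rightarrow> bool" where
  "neighborly i \<Delta> \<longleftrightarrow> (\<forall>\<sigma>. \<sigma> \<subseteq> vertex_set \<Delta> \<and> card \<sigma> = i \<longrightarrow> \<sigma> \<in> \<Delta>)"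

text \<open>The parameter \<open>d\<close> is one more than the dimension of the sphere, and is positive.\<close>

definition neighborly_sphere :: "nat \<Rightarrow> 'a set set \<Rightarrow> bool" where
  "neighborly_sphere d \<Delta> \<longleftrightarrow> 1 \<le> d \<and> simplicial_sphere (d - 1) \<Delta> \<and> neighborly (d div 2) \<Delta>"

definition lk :: "'a \<Rightarrow> 'a set set \<Rightarrow> 'a set set" where
  "lk v \<Delta> = {\<sigma> \<in> \<Delta>. \<sigma> \<union> {v} \<in> \<Delta> \<and> v \<notin> \<sigma>}"

definition missing_faces :: "nat \<Rightarrow> 'a set set \<Rightarrow> 'a set set" where
  "missing_faces i \<Delta> =
     {\<sigma>. \<sigma> \<subseteq> vertex_set \<Delta> \<and> card \<sigma> = i + 1 \<and> \<sigma> \<notin> \<Delta> \<and> (\<forall>\<tau>. \<tau> \<subset> \<sigma> \<longrightarrow> \<tau> \<in> \<Delta>)}"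

definition num_missing :: "nat \<Rightarrow> 'a set set \<Rightarrow> nat" where
  "num_missing i \<Delta> = card (missing_faces i \<Delta>)"

definition complex_isomorphic :: "'a set set \<Rightarrow> 'b set set \<Rightarrow> bool" where
  "complex_isomorphic \<Delta> \<Gamma> \<longleftrightarrow>
     (\<exists>f. bij_betw f (vertex_set \<Delta>) (vertex_set \<Gamma>) \<and> (\<lambda>\<sigma>. f ` \<sigma>) ` \<Delta> = \<Gamma>)"

definition simplicial_polytope :: "'b::euclidean_space set \<Rightarrow> bool" where
  "simplicial_polytope P \<longleftrightarrow>
     polytope P \<and> (\<forall>F. F face_of P \<and> F \<noteq> P \<longrightarrow> (\<exists>n. n simplex F))"

text \<open>The empty set counts as a proper face, contributing the empty vertex set.\<close>

definition boundary_complex :: "'b::euclidean_space set \<Rightarrow> 'b set set" where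
  "boundary_complex P = {{x. x extreme_point_of F} | F. F face_of P \<and> F \<noteq> P}"

text \<open>
  The type argument is the ambient space of the polytope. A complex is polytopal if this
  holds for some Euclidean space; it is not polytopal if
  \<open>\<not> polytopal TYPE('b) \<Delta>\<close> holds for every \<open>'b\<close>, i.e. with \<open>'b\<close> a free type variable.
\<close>

definition polytopal :: "'b::euclidean_space itself \<Rightarrow> 'a set set \<Rightarrow> bool" where
  "polytopal _ \<Delta> \<longleftrightarrow>
     (\<exists>P :: 'b set. simplicial_polytope P \<and> complex_isomorphic \<Delta> (boundary_complex P))"

end

theory Submission
  imports Defs "HOL-Homology.Homology"
begin

text \<open>
  Suppose \<open>\<Delta>\<close> is the boundary complex of a polytope \<open>P\<close> with vertex set \<open>V\<close>. Invariance of domain gives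
  \<open>dim P \<le> 2k\<close>, and neighborliness says that every nonzero affine dependence of \<open>V\<close> has at least
  \<open>k + 1\<close> positive and \<open>k + 1\<close> negative coefficients. Nothing else about \<open>P\<close> is needed: let \<open>N\<close> be the
  number of nonfaces of size \<open>k + 1\<close> and \<open>N\<^sub>p\<close> the number of those containing the vertex \<open>p\<close>.
  Ray shooting in quotients gives, for distinct vertices \<open>p\<close> and \<open>q\<close>, a bijection between the facets avoiding
  \<open>p\<close> and \<open>q\<close> and the nonfaces of size \<open>k + 1\<close> that contain \<open>p\<close> but not \<open>q\<close>; by symmetry \<open>N\<^sub>p\<close> does not depend
  on \<open>p\<close>. A second bijection of this kind relates \<open>P\<close> to the convex hull of \<open>V - {p}\<close>, and double counting
  yields \<open>(k + 1) N = n (n - k - 2 choose k)\<close> by induction on the number \<open>n\<close> of vertices.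
  The missing \<open>k\<close>-faces of the link of \<open>p\<close> turn out to be the nonfaces of size \<open>k + 1\<close> that avoid \<open>p\<close> and
  become faces when \<open>p\<close> is deleted; their number is \<open>N - N\<^sub>p - N'\<close>, where \<open>N'\<close> is \<open>N\<close> for \<open>V - {p}\<close>.
\<close>

section \<open>Balanced dependences\<close>

definition neg_part :: "('a \<Rightarrow> real) \<Rightarrow> 'a set" where
  "neg_part x = {u. x u < 0}"

lemma neg_part_nonneg: "neg_part x \<subseteq> S \<Longrightarrow> u \<notin> S \<Longrightarrow> 0 \<le> x u"
  unfolding neg_part_def by (metis (mono_tags) linorder_not_le mem_Collect_eq subsetD)

definition supp :: "('a \<Rightarrow> real) \<Rightarrow> 'a set" where
  "supp x = {u. x u \<noteq> 0}"

text \<open>For the affine dependences among the vertices of a polytope \<open>P\<close>, \<open>free_in L S\<close> says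
  that \<open>S\<close> spans a proper face of \<open>P\<close>: a nonzero dependence with negative part inside \<open>S\<close> would
  exhibit a point of the affine hull of \<open>S\<close> in the convex hull of the other vertices.
  Passing to \<open>del p L\<close> replaces \<open>P\<close> by the convex hull of the vertices other than \<open>p\<close>.\<close>

definition free_in :: "('a \<Rightarrow> real) set \<Rightarrow> 'a set \<Rightarrow> bool" where
  "free_in L S \<longleftrightarrow> (\<forall>x\<in>L. neg_part x \<subseteq> S \<longrightarrow> x = (\<lambda>_. 0))"

definition del :: "'a \<Rightarrow> ('a \<Rightarrow> real) set \<Rightarrow> ('a \<Rightarrow> real) set" where
  "del p L = {x \<in> L. x p = 0}"

lemma free_in_mono: "free_in L T \<Longrightarrow> S \<subseteq> T \<Longrightarrow> free_in L S"
  unfolding free_in_def by blast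

lemma free_in_del: "free_in L S \<Longrightarrow> free_in (del p L) S"
  unfolding free_in_def del_def by blast

section \<open>Small perturbations, extremal elements and counting tools\<close>

lemma small_perturbation:
  fixes x y :: "'a \<Rightarrow> real"
  assumes "finite F" "\<And>u. u \<in> F \<Longrightarrow> x u \<noteq> 0"
  obtains e where "0 < e" "\<And>u. u \<in> F \<Longrightarrow> e * \<bar>y u\<bar> < \<bar>x u\<bar>"
proof -
  have "\<exists>e>0. \<forall>u\<in>F. e * \<bar>y u\<bar> < \<bar>x u\<bar>"
    using assms
  proof (induction F rule: finite_induct)
    case empty
    show ?case by (auto intro: exI[of _ 1])
  next
    case (insert a F)
    then obtain e where e: "0 < e" "\<forall>u\<in>F. e * \<bar>y u\<bar> < \<bar>x u\<bar>" by auto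
    define e' where "e' = min e (\<bar>x a\<bar> / (\<bar>y a\<bar> + 1))"
    have xa: "\<bar>x a\<bar> > 0" using insert by auto
    have "e' > 0" unfolding e'_def using e xa by auto
    moreover have "e' * \<bar>y u\<bar> < \<bar>x u\<bar>" if "u \<in> F" for u
    proof -
      have "e' * \<bar>y u\<bar> \<le> e * \<bar>y u\<bar>" unfolding e'_def by (intro mult_right_mono) auto
      then show ?thesis using e that by force
    qed
    moreover have "e' * \<bar>y a\<bar> < \<bar>x a\<bar>"
    proof -
      have "e' * \<bar>y a\<bar> < e' * (\<bar>y a\<bar> + 1)" using \<open>e' > 0\<close> by simp
      also have "\<dots> \<le> \<bar>x a\<bar> / (\<bar>y a\<bar> + 1) * (\<bar>y a\<bar> + 1)"
        unfolding e'_def by (intro mult_right_mono) auto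
      also have "\<dots> = \<bar>x a\<bar>" by simp
      finally show ?thesis .
    qed
    ultimately show ?case by blast
  qed
  then show ?thesis using that by blast
qed

lemma finite_min:
  fixes f :: "'a \<Rightarrow> real"
  assumes "finite S" "S \<noteq> {}"
  shows "\<exists>a\<in>S. \<forall>b\<in>S. f a \<le> f b"
proof -
  have "Min (f ` S) \<in> f ` S" using assms by simp
  then obtain a where "a \<in> S" "Min (f ` S) = f a" by auto
  then show ?thesis using assms by (metis Min_le finite_imageI imageI)
qed

lemma finite_max:
  fixes f :: "'a \<Rightarrow> real"
  assumes "finite S" "S \<noteq> {}"
  shows "\<exists>a\<in>S. \<forall>b\<in>S. f b \<le> f a"
  using finite_min[OF assms, of "\<lambda>x. - f x"] by simp

text \<open>Both bijections below are given by the existence of a circuit with prescribed support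
  and signs, so unique existence in each direction replaces an explicit map.\<close>

lemma card_eq_if_relation_bijective:
  assumes AB: "\<And>a. a \<in> A \<Longrightarrow> \<exists>!b. b \<in> B \<and> r a b"
    and BA: "\<And>b. b \<in> B \<Longrightarrow> \<exists>!a. a \<in> A \<and> r a b"
  shows "card A = card B"
proof -
  define f where "f a = (THE b. b \<in> B \<and> r a b)" for a
  have f: "f a \<in> B \<and> r a (f a)" if "a \<in> A" for a
    unfolding f_def by (rule theI'[OF AB[OF that]])
  have "bij_betw f A B"
  proof (rule bij_betwI')
    fix x y assume "x \<in> A" "y \<in> A"
    then show "(f x = f y) = (x = y)" using f BA by metis
  next
    fix x assume "x \<in> A" then show "f x \<in> B" using f by blast
  next
    fix y assume "y \<in> B"
    then obtain a where "a \<in> A" "r a y" using BA by blast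
    then have "y = f a" using AB f \<open>y \<in> B\<close> by blast
    then show "\<exists>x\<in>A. y = f x" using \<open>a \<in> A\<close> by blast
  qed
  then show ?thesis by (rule bij_betw_same_card)
qed

text \<open>Double count the pairs \<open>(q, A)\<close> with \<open>q\<close> in
  \<open>W - A\<close>.\<close>

lemma sum_card_avoiding:
  assumes "finite W" "finite \<A>" "\<And>A. A \<in> \<A> \<Longrightarrow> card (W - A) = m"
  shows "(\<Sum>q\<in>W. card {A \<in> \<A>. q \<notin> A}) = m * card \<A>"
proof -
  have "(\<Sum>q\<in>W. card {A \<in> \<A>. q \<notin> A}) = (\<Sum>q\<in>W. \<Sum>A\<in>\<A>. if q \<notin> A then 1 else 0)"
    using assms by (simp add: sum.If_cases Int_def)
  also have "\<dots> = (\<Sum>A\<in>\<A>. \<Sum>q\<in>W. if q \<notin> A then 1 else 0)" by (rule sum.swap)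
  also have "\<dots> = (\<Sum>A\<in>\<A>. card (W - A))"
    using assms by (intro sum.cong) (simp_all add: sum.If_cases Diff_eq Compl_eq)
  also have "\<dots> = m * card \<A>" using assms by simp
  finally show ?thesis .
qed

text \<open>An abstract form of the space of affine dependences of a \<open>k\<close>-neighborly
  polytope with vertex set \<open>V\<close>: \<open>neg_card\<close> encodes neighborliness, and
  \<open>dependence_ex\<close> encodes dimension at most \<open>2 * k\<close>. Stated without a
  polytope, it passes directly to \<open>del p L\<close>, as the induction on the number of vertices
  requires.\<close>

locale balanced_dependences =
  fixes V :: "'a set" and L :: "('a \<Rightarrow> real) set" and k :: nat
  assumes finite_V: "finite V"
    and L_add: "\<And>x y. x \<in> L \<Longrightarrow> y \<in> L \<Longrightarrow> (\<lambda>u. x u + y u) \<in> L"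
    and L_scale: "\<And>c x. x \<in> L \<Longrightarrow> (\<lambda>u. c * x u) \<in> L"
    and supp_subset: "\<And>x. x \<in> L \<Longrightarrow> supp x \<subseteq> V"
    and neg_card: "\<And>x. x \<in> L \<Longrightarrow> x \<noteq> (\<lambda>_. 0) \<Longrightarrow> k + 1 \<le> card (neg_part x)"
    and dependence_ex:
      "\<And>S. S \<subseteq> V \<Longrightarrow> card S = 2 * k + 2 \<Longrightarrow> \<exists>x\<in>L. x \<noteq> (\<lambda>_. 0) \<and> supp x \<subseteq> S"
begin

section \<open>Circuits: dependences of smallest support\<close>

lemma L_comb: "x \<in> L \<Longrightarrow> y \<in> L \<Longrightarrow> (\<lambda>u. x u + c * y u) \<in> L"
  using L_add[OF _ L_scale] by blast

lemma L_diff: "x \<in> L \<Longrightarrow> y \<in> L \<Longrightarrow> (\<lambda>u. x u - y u) \<in> L"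
  using L_comb[of x y "-1"] by simp

lemma finite_supp: "x \<in> L \<Longrightarrow> finite (supp x)"
  using supp_subset finite_V finite_subset by blast

lemma neg_subset_supp: "neg_part x \<subseteq> supp x"
  unfolding neg_part_def supp_def by auto

text \<open>\<open>neg_card\<close> applies to \<open>x\<close> and to \<open>- x\<close>, whose
  negative parts are disjoint and together make up the support.\<close>

lemma balanced:
  assumes "x \<in> L" "x \<noteq> (\<lambda>_. 0)"
  shows "2 * k + 2 \<le> card (supp x)"
    and "card (supp x) = 2 * k + 2 \<Longrightarrow> card (neg_part x) = k + 1"
proof -
  define y where "y = (\<lambda>u. -1 * x u)"
  have y: "y \<in> L" unfolding y_def using assms L_scale by blast
  have "y \<noteq> (\<lambda>_. 0)" using assms(2) unfolding y_def by (auto simp: fun_eq_iff)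
  then have 1: "k + 1 \<le> card (neg_part y)" using neg_card y by blast
  have 2: "k + 1 \<le> card (neg_part x)" using neg_card assms by blast
  have "supp x = neg_part x \<union> neg_part y"
    unfolding supp_def neg_part_def y_def by auto
  moreover have "neg_part x \<inter> neg_part y = {}" unfolding neg_part_def y_def by auto
  moreover have "finite (neg_part x)" "finite (neg_part y)"
    using finite_subset[OF neg_subset_supp finite_supp] assms(1) y by blast+
  ultimately have "card (supp x) = card (neg_part x) + card (neg_part y)"
    by (simp add: card_Un_disjoint)
  then show "2 * k + 2 \<le> card (supp x)"
    and "card (supp x) = 2 * k + 2 \<Longrightarrow> card (neg_part x) = k + 1" using 1 2 by linarith+
qed

lemma neg_eq:
  assumes "x \<in> L" "x \<noteq> (\<lambda>_. 0)" "neg_part x \<subseteq> S" "finite S" "card S \<le> k + 1"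
  shows "neg_part x = S"
  using card_seteq[OF assms(4,3)] neg_card[OF assms(1,2)] assms(5) by linarith

text \<open>\<open>x - y\<close> vanishes at \<open>p\<close>, so its support has at most
  \<open>2 * k + 1\<close> elements, too few for a nonzero dependence.\<close>

lemma circuit_unique:
  assumes "x \<in> L" "y \<in> L" "supp x = S" "supp y = S" "card S = 2 * k + 2" "p \<in> S" "x p = y p"
  shows "x = y"
proof (rule ccontr)
  assume "x \<noteq> y"
  define z where "z = (\<lambda>u. x u - y u)"
  have z: "z \<in> L" unfolding z_def by (intro L_diff assms)
  have "z \<noteq> (\<lambda>_. 0)" using \<open>x \<noteq> y\<close> unfolding z_def by (auto simp: fun_eq_iff)
  then have "2 * k + 2 \<le> card (supp z)" using balanced(1)[OF z] by blast
  moreover have "supp z \<subseteq> (supp x \<union> supp y) - {p}"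
    using assms(7) unfolding supp_def z_def by auto
  then have "supp z \<subseteq> S - {p}" by (simp add: assms(3,4))
  moreover have "card (S - {p}) < 2 * k + 2" using assms by (simp add: card_Diff_singleton)
  moreover have "finite (S - {p})" using finite_supp[OF assms(1)] assms(3) by simp
  ultimately show False using card_mono[of "S - {p}" "supp z"] by linarith
qed

text \<open>Balancedness leaves a nonzero dependence supported in \<open>S\<close> no room for a
  zero coefficient, so any nonzero value at \<open>p\<close> can be reached by rescaling.\<close>

lemma circuit_ex:
  assumes "S \<subseteq> V" "card S = 2 * k + 2" "p \<in> S" "s \<noteq> 0"
  obtains x where "x \<in> L" "supp x = S" "x p = s"
proof -
  obtain x where x: "x \<in> L" "x \<noteq> (\<lambda>_. 0)" "supp x \<subseteq> S" using dependence_ex[OF assms(1,2)] by blast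
  have "finite S" using assms finite_V finite_subset by blast
  then have S: "supp x = S" using card_seteq[of S "supp x"] balanced(1) x assms by simp
  then have xp: "x p \<noteq> 0" using assms unfolding supp_def by blast
  define y where "y = (\<lambda>u. s / x p * x u)"
  have "y \<in> L" unfolding y_def using x L_scale by blast
  moreover have "supp y = S" using S xp assms unfolding supp_def y_def by auto
  moreover have "y p = s" using xp unfolding y_def by simp
  ultimately show ?thesis using that by blast
qed

lemma nonzeroI: "x p \<noteq> 0 \<Longrightarrow> x \<noteq> (\<lambda>_. 0)"
  by auto

text \<open>A step of the simplex algorithm that maximises \<open>x q\<close> over the dependences with \<open>x p = s\<close> that
  are nonnegative outside \<open>insert p R\<close>; freeness of \<open>R\<close> makes the problem bounded.\<close>

lemma pivot_step:
  assumes x: "x \<in> L" "x p = s" "\<And>u. u \<notin> insert p R \<Longrightarrow> 0 \<le> x u"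
    and pq: "p \<in> V" "q \<in> V" "p \<noteq> q" "p \<notin> R" "q \<notin> R" and R: "free_in (del p L) R"
    and large: "2 * k + 3 \<le> card (insert q (supp x))"
  shows "\<exists>y\<in>L. y p = s \<and> (\<forall>u. u \<notin> insert p R \<longrightarrow> 0 \<le> y u) \<and> x q < y q \<and>
    card (insert q (supp y)) < card (insert q (supp x))"
proof -
  define T where "T = insert q (supp x)"
  have finT: "finite T" unfolding T_def using finite_supp x by simp
  have TV: "T \<subseteq> V" unfolding T_def using supp_subset x pq by blast
  have "2 * k + 1 \<le> card (T - {p, q})"
  proof -
    have "card T - card {p, q} \<le> card (T - {p, q})" by (rule diff_card_le_card_Diff) simp
    then show ?thesis using large pq unfolding T_def[symmetric] by simp
  qed
  \<comment> \<open>\<open>2 * k + 1\<close> support points besides \<open>p\<close> and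
    \<open>q\<close>, completed by \<open>q\<close> to a circuit \<open>z\<close>: the direction of
    the pivot, along which \<open>x q\<close> grows and \<open>x p\<close> is fixed.\<close>
  then obtain S where S: "S \<subseteq> T - {p, q}" "card S = 2 * k + 1" by (meson obtain_subset_with_card_n)
  have finS: "finite S" using S finT finite_subset by blast
  have "card (insert q S) = 2 * k + 2" using S finS by (subst card_insert_disjoint) auto
  then obtain z where z: "z \<in> L" "supp z = insert q S" "z q = 1"
    using circuit_ex[of "insert q S" q 1] S TV pq by auto
  have zp: "z p = 0" using z(2) S pq unfolding supp_def by auto
  \<comment> \<open>The constrained coordinates that decrease along \<open>z\<close>. Without any,
    \<open>z\<close> would be a nonzero dependence of the deletion negative only in
    \<open>R\<close>.\<close>
  define H where "H = neg_part z - R"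
  have "H \<noteq> {}"
  proof
    assume "H = {}"
    then have "neg_part z \<subseteq> R" unfolding H_def by blast
    then have "z = (\<lambda>_. 0)" using R z zp unfolding free_in_def del_def by blast
    then show False using z(3) by simp
  qed
  have HS: "H \<subseteq> S" unfolding H_def using neg_subset_supp[of z] z by (auto simp: neg_part_def)
  have finH: "finite H" using HS finS finite_subset by blast
  define g where "g u = x u / - z u" for u
  obtain a where a: "a \<in> H" "\<And>u. u \<in> H \<Longrightarrow> g a \<le> g u"
    using finite_min[OF finH \<open>H \<noteq> {}\<close>] by blast
  have posx: "0 < x u" if "u \<in> H" for u
  proof -
    have "u \<in> supp x" "u \<noteq> p" "u \<notin> R" using that HS S unfolding T_def H_def by auto
    then show ?thesis using x(3)[of u] unfolding supp_def by auto
  qed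
  have negz: "z u < 0" if "u \<in> H" for u using that unfolding H_def neg_part_def by simp
  \<comment> \<open>Ratio test: the longest feasible step. It annihilates the coefficient at
    \<open>a\<close>, and no coefficient outside \<open>T\<close> appears.\<close>
  define t where "t = g a"
  have t: "0 < t" unfolding t_def g_def using posx[OF a(1)] negz[OF a(1)]
    by (simp add: field_simps)
  define y where "y = (\<lambda>u. x u + t * z u)"
  have "y \<in> L" unfolding y_def by (intro L_comb x z)
  moreover have "y p = s" unfolding y_def using zp x by simp
  moreover have "0 \<le> y u" if "u \<notin> insert p R" for u
  proof (cases "u \<in> H")
    case True
    then have "t \<le> x u / - z u" using a(2) unfolding t_def g_def by blast
    then show ?thesis unfolding y_def using negz[OF True] by (simp add: field_simps)
  next
    case False
    then have "0 \<le> z u" using that unfolding H_def neg_part_def by auto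
    then show ?thesis unfolding y_def using x(3)[OF that] t by simp
  qed
  moreover have "x q < y q" unfolding y_def using z t by simp
  moreover have "insert q (supp y) \<subset> T"
  proof -
    have "supp y \<subseteq> supp x \<union> supp z" unfolding supp_def y_def by auto
    then have "insert q (supp y) \<subseteq> T" using z S unfolding T_def by auto
    moreover have "y a = 0" unfolding y_def t_def g_def using negz[OF a(1)] by (simp add: field_simps)
    moreover have "a \<in> T" "a \<noteq> q" using a HS S by auto
    ultimately show ?thesis unfolding supp_def by auto
  qed
  then have "card (insert q (supp y)) < card (insert q (supp x))"
    using psubset_card_mono finT unfolding T_def by blast
  ultimately show ?thesis by blast
qed

text \<open>Repeated pivoting terminates because \<open>card (insert q (supp x))\<close> drops;
  \<open>q\<close> is always counted, so that its entering the support costs nothing.\<close>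

lemma pivot_reduce:
  assumes x: "x \<in> L" "x p = s" "\<And>u. u \<notin> insert p R \<Longrightarrow> 0 \<le> x u"
    and pq: "p \<in> V" "q \<in> V" "p \<noteq> q" "p \<notin> R" "q \<notin> R" and R: "free_in (del p L) R"
  shows "\<exists>y\<in>L. y p = s \<and> (\<forall>u. u \<notin> insert p R \<longrightarrow> 0 \<le> y u) \<and> x q \<le> y q \<and>
    card (insert q (supp y)) \<le> 2 * k + 2"
  using x
proof (induction "card (insert q (supp x))" arbitrary: x rule: less_induct)
  case less
  show ?case
  proof (cases "card (insert q (supp x)) \<le> 2 * k + 2")
    case True
    then show ?thesis using less.prems by blast
  next
    case False
    then have "2 * k + 3 \<le> card (insert q (supp x))" by simp
    from pivot_step[OF less.prems pq R this]
    obtain y where y: "y \<in> L" "y p = s" "\<And>u. u \<notin> insert p R \<Longrightarrow> 0 \<le> y u" "x q < y q"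
      "card (insert q (supp y)) < card (insert q (supp x))"
      by blast
    from less.hyps[OF y(5,1,2,3)] obtain z where
      z: "z \<in> L" "z p = s" "\<forall>u. u \<notin> insert p R \<longrightarrow> 0 \<le> z u" "y q \<le> z q"
        "card (insert q (supp z)) \<le> 2 * k + 2" by blast
    have "x q \<le> z q" using y(4) z(4) by simp
    then show ?thesis using z by blast
  qed
qed

text \<open>Basic solutions are determined by their supports, so there are finitely many, and one
  maximising \<open>x q\<close> among them is optimal overall. Optimality makes \<open>F\<close>
  free: a dependence of the deletion violating this could be added in a small amount, enlarging the
  support without lowering \<open>x q\<close>.\<close>

lemma pivot:
  assumes x0: "x0 \<in> L" "x0 p = s" "\<And>u. u \<notin> insert p R \<Longrightarrow> 0 \<le> x0 u"
    and s: "s \<noteq> 0"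
    and pq: "p \<in> V" "q \<in> V" "p \<noteq> q" "p \<notin> R" "q \<notin> R" and R: "free_in (del p L) R"
  obtains F x where "F \<subseteq> V - {p, q}" "card F = 2 * k" "free_in (del p L) F"
    "x \<in> L" "x p = s" "0 < x q" "supp x = insert p (insert q F)"
    "\<And>u. u \<notin> insert p R \<Longrightarrow> 0 \<le> x u"
proof -
  define feas where
    "feas = {x \<in> L. x p = s \<and> (\<forall>u. u \<notin> insert p R \<longrightarrow> 0 \<le> x u)}"
  define basic where "basic = {x \<in> feas. card (insert q (supp x)) \<le> 2 * k + 2}"
  have supp_basic: "card (supp x) = 2 * k + 2 \<and> q \<in> supp x" if "x \<in> basic" for x
  proof -
    have x: "x \<in> L" "x p = s" "card (insert q (supp x)) \<le> 2 * k + 2"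
      using that unfolding basic_def feas_def by auto
    then have "2 * k + 2 \<le> card (supp x)" using balanced(1)[of x] nonzeroI[of x p] s by blast
    then show ?thesis using x finite_supp[OF x(1)] by (cases "q \<in> supp x") (auto simp: insert_absorb)
  qed
  have p_supp: "p \<in> supp x" if "x \<in> feas" for x using that s unfolding feas_def supp_def by auto
  have "inj_on supp basic"
  proof (rule inj_onI)
    fix x y assume xy: "x \<in> basic" "y \<in> basic" "supp x = supp y"
    have "x \<in> feas" "x \<in> L" "y \<in> L" "x p = y p" using xy unfolding basic_def feas_def by auto
    then show "x = y"
      using circuit_unique[OF _ _ refl xy(3)[symmetric]] supp_basic[OF xy(1)] p_supp[of x] by blast
  qed
  moreover have "supp ` basic \<subseteq> Pow V" unfolding basic_def feas_def using supp_subset by auto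
  ultimately have fin: "finite basic"
    using finite_imageD[OF finite_subset] finite_V by blast
  have reduce: "\<exists>y\<in>basic. x q \<le> y q" if "x \<in> feas" for x
    using pivot_reduce[of x p s R q] that pq R unfolding basic_def feas_def by auto
  have "basic \<noteq> {}" using reduce[of x0] x0 unfolding feas_def by auto
  then obtain x where x: "x \<in> basic" "\<And>y. y \<in> basic \<Longrightarrow> y q \<le> x q"
    using finite_max[OF fin, of "\<lambda>x. x q"] by blast
  have max: "y q \<le> x q" if "y \<in> feas" for y using reduce[OF that] x(2) order_trans by blast
  have max_basic: "y \<in> basic" if y: "y \<in> feas" "x q \<le> y q" for y
  proof (rule ccontr)
    assume "y \<notin> basic"
    then have large: "2 * k + 3 \<le> card (insert q (supp y))" using y unfolding basic_def by simp
    have "y \<in> L" "y p = s" "\<And>u. u \<notin> insert p R \<Longrightarrow> 0 \<le> y u" using y unfolding feas_def by auto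
    then obtain z where "z \<in> feas" "y q < z q"
      using pivot_step[OF _ _ _ pq R large] unfolding feas_def by blast
    then show False using max[of z] y by simp
  qed
  have xf: "x \<in> feas" and xL: "x \<in> L" "x p = s" "\<And>u. u \<notin> insert p R \<Longrightarrow> 0 \<le> x u"
    using x unfolding basic_def feas_def by auto
  have sx: "card (supp x) = 2 * k + 2" "q \<in> supp x" using supp_basic x by auto
  define F where "F = supp x - {p, q}"
  have suppx: "supp x = insert p (insert q F)" unfolding F_def using sx p_supp[OF xf] by blast
  have finF: "finite F" unfolding F_def using finite_supp xL by simp
  have cF: "card F = 2 * k"
  proof -
    have "p \<notin> insert q F" "q \<notin> F" using pq unfolding F_def by auto
    then show ?thesis using sx(1) finF by (simp add: suppx)
  qed
  have xq: "0 < x q" using sx(2) xL(3)[of q] pq unfolding supp_def by auto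
  have "free_in (del p L) F"
    unfolding free_in_def
  proof (intro ballI impI, rule ccontr)
    fix y assume y: "y \<in> del p L" "neg_part y \<subseteq> F" "y \<noteq> (\<lambda>_. 0)"
    then have yL: "y \<in> L" "y p = 0" unfolding del_def by auto
    have ypos: "0 \<le> y u" if "u \<notin> F" for u using neg_part_nonneg[OF y(2) that] .
    have "x u \<noteq> 0" if "u \<in> F" for u using that unfolding F_def supp_def by simp
    then obtain e where e: "0 < e" "\<And>u. u \<in> F \<Longrightarrow> e * \<bar>y u\<bar> < \<bar>x u\<bar>"
      using small_perturbation[OF finF] by blast
    define z where "z = (\<lambda>u. x u + e * y u)"
    have zF: "z u \<noteq> 0 \<and> (0 \<le> x u \<longrightarrow> 0 \<le> z u)" if "u \<in> F" for u
    proof -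
      have "\<bar>e * y u\<bar> < \<bar>x u\<bar>" using e that by (simp add: abs_mult)
      then show ?thesis unfolding z_def by linarith
    qed
    have "0 \<le> z u" if "u \<notin> insert p R" for u
      using zF[of u] xL(3)[OF that] ypos[of u] e(1) unfolding z_def by (cases "u \<in> F") auto
    then have zfeas: "z \<in> feas"
      unfolding feas_def using L_comb[OF xL(1) yL(1), of e] yL(2) xL(2) by (simp add: z_def)
    have yq: "0 \<le> y q" using ypos unfolding F_def by blast
    have zq: "z q = x q + e * y q" unfolding z_def ..
    then have "z \<in> basic" using max_basic[OF zfeas] yq e by simp
    have "y q = 0" using max[OF zfeas] zq yq e(1)
      by (smt (verit) mult_pos_pos)
    \<comment> \<open>The support of \<open>y\<close> has more than \<open>2 * k\<close> elements,
      so it leaves \<open>F\<close>. At such a point \<open>a\<close> the support of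
      \<open>z\<close> grows, although the basic \<open>z\<close> has support of size
      \<open>2 * k + 2\<close> like \<open>x\<close>.\<close>
    have "\<not> supp y \<subseteq> F"
      using balanced(1)[OF yL(1) y(3)] cF finF card_mono[of F "supp y"] by auto
    then obtain a where a: "y a \<noteq> 0" "a \<notin> F" unfolding supp_def by auto
    then have ap: "a \<noteq> p" "a \<noteq> q" using \<open>y q = 0\<close> yL by auto
    have "x a = 0" using a ap suppx unfolding supp_def by auto
    then have "a \<in> supp z" using a e unfolding z_def supp_def by auto
    moreover have "z q \<noteq> 0" using zq xq yq e \<open>y q = 0\<close> by simp
    ultimately have "insert a (supp x) \<subseteq> supp z"
      using zF p_supp[OF zfeas] suppx unfolding supp_def by auto
    moreover have "a \<notin> supp x" using a ap suppx by auto
    ultimately have "supp x \<subset> supp z" by blast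
    moreover have "finite (supp z)" using finite_supp zfeas unfolding feas_def by blast
    ultimately have "card (supp x) < card (supp z)" by (simp add: psubset_card_mono)
    then show False using supp_basic[OF \<open>z \<in> basic\<close>] sx by simp
  qed
  moreover have "F \<subseteq> V - {p, q}" unfolding F_def using supp_subset xL by blast
  ultimately show ?thesis using that cF xL xq suppx by blast
qed

end

section \<open>Facets and nonfaces\<close>

text \<open>In a balanced system \<open>k + 1\<close> is the smallest size at which
  \<open>free_in\<close> can fail, and the nonfaces of this size are exactly the negative parts of
  that size.\<close>

definition nonfaces :: "'a set \<Rightarrow> ('a \<Rightarrow> real) set \<Rightarrow> nat \<Rightarrow> 'a set set" where
  "nonfaces V L k = {S. S \<subseteq> V \<and> card S = k + 1 \<and> \<not> free_in L S}"

definition facets :: "'a set \<Rightarrow> ('a \<Rightarrow> real) set \<Rightarrow> nat \<Rightarrow> 'a set set" where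
  "facets V L k = {F. F \<subseteq> V \<and> card F = 2 * k \<and> free_in L F}"

text \<open>The circuit on \<open>p\<close>, \<open>q\<close> and the facet \<open>F\<close>, scaled
  to the value \<open>s\<close> at \<open>p\<close>, names the nonface \<open>S\<close>. The value
  \<open>-1\<close> of \<open>s\<close> serves for facets of the polytope, the value
  \<open>1\<close> for facets of the deletion of \<open>p\<close> that are visible from
  \<open>p\<close>.\<close>

definition pivots :: "('a \<Rightarrow> real) set \<Rightarrow> 'a \<Rightarrow> 'a \<Rightarrow> real \<Rightarrow> 'a set \<Rightarrow> 'a set \<Rightarrow> bool" where
  "pivots L p q s F S \<longleftrightarrow>
     (\<exists>x\<in>L. supp x = insert p (insert q F) \<and> x p = s \<and> 0 < x q \<and> neg_part x = S)"

section \<open>The two bijections between facets and nonfaces\<close>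

context balanced_dependences
begin

lemma balanced_dependences_del:
  assumes "p \<in> V"
  shows "balanced_dependences (V - {p}) (del p L) k"
proof
  show "finite (V - {p})" using finite_V by simp
  show "(\<lambda>u. x u + y u) \<in> del p L" if "x \<in> del p L" "y \<in> del p L" for x y
    using that L_add unfolding del_def by simp
  show "(\<lambda>u. c * x u) \<in> del p L" if "x \<in> del p L" for c x
    using that L_scale unfolding del_def by simp
  show "supp x \<subseteq> V - {p}" if "x \<in> del p L" for x
  proof -
    have "x \<in> L" "x p = 0" using that unfolding del_def by auto
    then show ?thesis using supp_subset[of x] unfolding supp_def by auto
  qed
  show "k + 1 \<le> card (neg_part x)" if "x \<in> del p L" "x \<noteq> (\<lambda>_. 0)" for x
    using that neg_card unfolding del_def by blast
  show "\<exists>x\<in>del p L. x \<noteq> (\<lambda>_. 0) \<and> supp x \<subseteq> S" if "S \<subseteq> V - {p}" "card S = 2 * k + 2" for S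
  proof -
    have "S \<subseteq> V" using that by blast
    from dependence_ex[OF this that(2)] obtain x where
      x: "x \<in> L" "x \<noteq> (\<lambda>_. 0)" "supp x \<subseteq> S" by blast
    have "p \<notin> supp x" using x that by blast
    then have "x \<in> del p L" using x unfolding del_def supp_def by simp
    then show ?thesis using x by blast
  qed
qed

lemma pivots_functional:
  assumes "pivots L p q s F S" "pivots L p q s F T" "card F = 2 * k" "p \<noteq> q" "p \<notin> F" "q \<notin> F"
    "finite F"
  shows "S = T"
proof -
  obtain x y where xy: "x \<in> L" "y \<in> L" "supp x = insert p (insert q F)"
    "supp y = insert p (insert q F)" "x p = y p" "neg_part x = S" "neg_part y = T"
    using assms(1,2) unfolding pivots_def by auto
  have "card (insert p (insert q F)) = 2 * k + 2" using assms by simp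
  then have "x = y" using circuit_unique[OF xy(1-4) _ _ xy(5)] by blast
  then show ?thesis using xy by blast
qed

text \<open>\<open>x - y\<close> vanishes at \<open>p\<close> and is nonnegative at
  \<open>q\<close>; elsewhere off \<open>F'\<close> it cannot be negative, since \<open>y\<close>
  vanishes there and \<open>x\<close> has the same negative part. Freeness of \<open>F'\<close>
  makes it zero.\<close>

lemma pivots_unique_aux:
  assumes F: "free_in (del p L) F'" and pq: "p \<notin> F'" "q \<notin> F'"
    and x: "x \<in> L" "y \<in> L" "supp y = insert p (insert q F')"
      "x p = y p" "y q \<le> x q" "neg_part x = neg_part y"
  shows "x = y"
proof -
  define z where "z = (\<lambda>u. x u - y u)"
  have "z \<in> del p L" unfolding del_def using L_diff[OF x(1,2)] x(4) by (simp add: z_def)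
  moreover have "neg_part z \<subseteq> F'"
  proof
    fix u assume u: "u \<in> neg_part z"
    show "u \<in> F'"
    proof (rule ccontr)
      assume "u \<notin> F'"
      moreover have "u \<noteq> p" "u \<noteq> q" using u x(4,5) unfolding neg_part_def z_def by auto
      ultimately have "u \<notin> supp y" using x(3) by simp
      then have "y u = 0" unfolding supp_def by simp
      moreover then have "u \<notin> neg_part x" unfolding x(6) by (simp add: neg_part_def)
      ultimately show False using u unfolding neg_part_def z_def by simp
    qed
  qed
  ultimately have "z = (\<lambda>_. 0)" using F unfolding free_in_def by blast
  then show ?thesis unfolding z_def by (simp add: fun_eq_iff)
qed

lemma pivots_unique:
  assumes F: "free_in (del p L) F" "p \<notin> F" "q \<notin> F" "free_in (del p L) F'" "p \<notin> F'" "q \<notin> F'"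
    and "pivots L p q s F S" "pivots L p q s F' S"
  shows "F = F'"
proof -
  obtain x y where xy: "x \<in> L" "y \<in> L" "supp x = insert p (insert q F)"
    "supp y = insert p (insert q F')" "x p = y p" "neg_part x = neg_part y"
    using assms(7,8) unfolding pivots_def by auto
  have "x = y"
  proof (cases "y q \<le> x q")
    case True
    then show ?thesis using pivots_unique_aux[OF F(4-6) xy(1,2,4,5) _ xy(6)] by blast
  next
    case False
    then have "x q \<le> y q" by simp
    then show ?thesis
      using pivots_unique_aux[OF F(1-3) xy(2,1,3) xy(5)[symmetric] _ xy(6)[symmetric]] by simp
  qed
  then show ?thesis using xy F by auto
qed

lemma pivots_neg_card:
  assumes "x \<in> L" "supp x = insert p (insert q F)" "card F = 2 * k" "p \<noteq> q" "p \<notin> F" "q \<notin> F"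
    "finite F"
  shows "card (neg_part x) = k + 1"
proof -
  have c: "card (supp x) = 2 * k + 2" using assms by simp
  have "p \<in> supp x" using assms by simp
  then have "x \<noteq> (\<lambda>_. 0)" unfolding supp_def by auto
  then show ?thesis using balanced(2) assms(1) c by blast
qed

lemma nonface_witness:
  assumes "S \<in> nonfaces V L k"
  obtains x where "x \<in> L" "x \<noteq> (\<lambda>_. 0)" "neg_part x = S"
proof -
  obtain x where x: "x \<in> L" "x \<noteq> (\<lambda>_. 0)" "neg_part x \<subseteq> S"
    using assms unfolding nonfaces_def free_in_def by blast
  have "finite S" "card S \<le> k + 1"
    using assms finite_V finite_subset unfolding nonfaces_def by auto
  then have "neg_part x = S" using neg_eq[OF x] by blast
  then show ?thesis using that x by blast
qed

lemma nonfaceI: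
  assumes "x \<in> L" "card (neg_part x) = k + 1"
  shows "neg_part x \<in> nonfaces V L k"
proof -
  have "neg_part x \<noteq> {}" using assms(2) by auto
  then have "x \<noteq> (\<lambda>_. 0)" unfolding neg_part_def by auto
  then show ?thesis
    using assms supp_subset[OF assms(1)] neg_subset_supp[of x]
    unfolding nonfaces_def free_in_def by blast
qed

text \<open>In the quotient by \<open>S - {p}\<close>, the nonface \<open>S\<close> puts \<open>p\<close> in the interior of the cone
  of the link, and moving from \<open>p\<close> in the direction \<open>- q\<close> leaves this cone through a unique facet.\<close>

lemma card_facets_avoiding:
  assumes pq: "p \<in> V" "q \<in> V" "p \<noteq> q"
  shows "card {F \<in> facets V L k. p \<notin> F \<and> q \<notin> F} = card {S \<in> nonfaces V L k. p \<in> S \<and> q \<notin> S}"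
    (is "card ?A = card ?B")
proof (rule card_eq_if_relation_bijective[where r = "pivots L p q (-1)"])
  fix F assume "F \<in> ?A"
  then have F: "F \<subseteq> V" "card F = 2 * k" "free_in L F" "p \<notin> F" "q \<notin> F"
    unfolding facets_def by auto
  have finF: "finite F" using F(1) finite_V finite_subset by blast
  have S: "insert p (insert q F) \<subseteq> V" "card (insert p (insert q F)) = 2 * k + 2"
    using F pq finF by auto
  obtain x where x: "x \<in> L" "supp x = insert p (insert q F)" "x p = -1"
    using circuit_ex[OF S, of p "-1"] by auto
  \<comment> \<open>Otherwise \<open>- x\<close> is nonnegative at \<open>p\<close> and
    \<open>q\<close>, hence negative only inside the free set \<open>F\<close>.\<close>
  have "0 < x q"
  proof (rule ccontr)
    assume "\<not> 0 < x q"
    define y where "y = (\<lambda>u. -1 * x u)"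
    have "y \<in> L" unfolding y_def by (rule L_scale[OF x(1)])
    moreover have "neg_part y \<subseteq> F"
    proof
      fix u assume u: "u \<in> neg_part y"
      then have "0 < x u" unfolding neg_part_def y_def by simp
      then have "u \<in> supp x" "u \<noteq> p" "u \<noteq> q"
        using x(3) \<open>\<not> 0 < x q\<close> unfolding supp_def by auto
      then show "u \<in> F" using x(2) by blast
    qed
    ultimately have "y = (\<lambda>_. 0)" using F(3) unfolding free_in_def by blast
    then have "y p = 0" by simp
    then show False unfolding y_def using x(3) by simp
  qed
  then have r: "pivots L p q (-1) F (neg_part x)" unfolding pivots_def using x by blast
  have "neg_part x \<in> ?B"
    using nonfaceI[OF x(1) pivots_neg_card[OF x(1,2) F(2) pq(3) F(4,5) finF]] x(3) \<open>0 < x q\<close>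
    by (simp add: neg_part_def)
  then show "\<exists>!S. S \<in> ?B \<and> pivots L p q (-1) F S"
    using r pivots_functional[OF _ r F(2) pq(3) F(4,5) finF] by blast
next
  fix S assume "S \<in> ?B"
  then have S: "S \<in> nonfaces V L k" "p \<in> S" "q \<notin> S" by auto
  then have cS: "card S = k + 1" "S \<subseteq> V" "finite S"
    using finite_V finite_subset unfolding nonfaces_def by auto
  obtain x1 where x1: "x1 \<in> L" "neg_part x1 = S" using nonface_witness[OF S(1)] by blast
  have x1p: "x1 p < 0" using S(2) x1(2) unfolding neg_part_def by blast
  define x0 where "x0 = (\<lambda>u. (- 1 / x1 p) * x1 u)"
  have x0: "x0 \<in> L" "x0 p = -1" unfolding x0_def by (rule L_scale[OF x1(1)], use x1p in simp)
  have x0pos: "0 \<le> x0 u" if "u \<notin> insert p (S - {p})" for u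
  proof -
    have "u \<notin> neg_part x1" using that x1(2) by blast
    then have "0 \<le> x1 u" unfolding neg_part_def by simp
    then show ?thesis unfolding x0_def using x1p by (simp add: divide_nonneg_neg)
  qed
  \<comment> \<open>This is neighborliness, as only \<open>k\<close> elements are left.\<close>
  have "free_in L (S - {p})"
    unfolding free_in_def
  proof (intro ballI impI, rule ccontr)
    fix y assume y: "y \<in> L" "neg_part y \<subseteq> S - {p}" "y \<noteq> (\<lambda>_. 0)"
    have "card (neg_part y) \<le> card (S - {p})" using y cS by (intro card_mono) auto
    then show False using neg_card[OF y(1,3)] cS S(2) by simp
  qed
  then have R: "free_in (del p L) (S - {p})" by (rule free_in_del)
  obtain F x where F: "F \<subseteq> V - {p, q}" "card F = 2 * k" "free_in (del p L) F"
    and x: "x \<in> L" "x p = -1" "0 < x q" "supp x = insert p (insert q F)"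
      "\<And>u. u \<notin> insert p (S - {p}) \<Longrightarrow> 0 \<le> x u"
    using pivot[OF x0 x0pos _ pq _ _ R] S(3) by auto
  have "neg_part x \<subseteq> S"
  proof
    fix u assume "u \<in> neg_part x"
    then have "\<not> 0 \<le> x u" unfolding neg_part_def by simp
    then show "u \<in> S" using x(5)[of u] S(2) by auto
  qed
  then have nx: "neg_part x = S"
    using neg_eq[OF x(1) nonzeroI[of x p] _ cS(3)] x(2) cS(1) by simp
  then have r: "pivots L p q (-1) F S" unfolding pivots_def using x by blast
  \<comment> \<open>\<open>pivot\<close> gives freeness only in the deletion of \<open>p\<close>. A
    violating \<open>y\<close> with \<open>y p > 0\<close> can be corrected by adding
    \<open>y p * x\<close>, which cancels \<open>p\<close> and leaves a positive value at
    \<open>q\<close>.\<close>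
  have "free_in L F"
    unfolding free_in_def
  proof (intro ballI impI)
    fix y assume y: "y \<in> L" "neg_part y \<subseteq> F"
    have ypos: "0 \<le> y u" if "u \<notin> F" for u using neg_part_nonneg[OF y(2) that] .
    have "y p = 0"
    proof (rule ccontr)
      assume "y p \<noteq> 0"
      define z where "z = (\<lambda>u. y u + y p * x u)"
      have "z \<in> del p L" unfolding del_def using L_comb[OF y(1) x(1), of "y p"] x(2) by (simp add: z_def)
      moreover have "neg_part z \<subseteq> F"
      proof
        fix u assume u: "u \<in> neg_part z"
        show "u \<in> F"
        proof (rule ccontr)
          assume "u \<notin> F"
          moreover have "u \<noteq> p" using u x(2) unfolding neg_part_def z_def by auto
          ultimately have "u = q \<or> u \<notin> supp x" using x(4) by simp
          then have "0 \<le> x u" using x(3) by (auto simp: supp_def)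
          moreover have "0 \<le> y u" "0 \<le> y p" using ypos \<open>u \<notin> F\<close> F(1) by auto
          moreover have "y u + y p * x u < 0" using u unfolding neg_part_def z_def by simp
          ultimately show False using mult_nonneg_nonneg[of "y p" "x u"] \<open>0 \<le> x u\<close> by linarith
        qed
      qed
      ultimately have "z = (\<lambda>_. 0)" using F(3) unfolding free_in_def by blast
      then have "z q = 0" by simp
      moreover have "0 < y p" using \<open>y p \<noteq> 0\<close> ypos[of p] F(1) by force
      then have "0 < y p * x q" using x(3) by simp
      moreover have "0 \<le> y q" using ypos F(1) by blast
      ultimately show False unfolding z_def using \<open>0 < y p * x q\<close> by linarith
    qed
    then have "y \<in> del p L" using y(1) unfolding del_def by simp
    then show "y = (\<lambda>_. 0)" using F(3) y(2) unfolding free_in_def by blast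
  qed
  then have "F \<in> ?A" using F unfolding facets_def by auto
  moreover have "G = F" if "G \<in> ?A" "pivots L p q (-1) G S" for G
  proof (rule pivots_unique[OF _ _ _ F(3) _ _ that(2) r])
    show "free_in (del p L) G" "p \<notin> G" "q \<notin> G"
      using that(1) free_in_del unfolding facets_def by auto
  qed (use F in auto)
  ultimately show "\<exists>!F. F \<in> ?A \<and> pivots L p q (-1) F S" using r by blast
qed

text \<open>The same argument for the deletion of \<open>p\<close>, in the quotient by \<open>S\<close>, starting from \<open>- p\<close>:
  on the left are the facets of the deletion that are visible from \<open>p\<close>.\<close>

lemma card_visible_facets_avoiding:
  assumes pq: "p \<in> V" "q \<in> V" "p \<noteq> q"
  shows "card {F \<in> facets (V - {p}) (del p L) k - facets V L k. q \<notin> F} =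
    card {S \<in> {S \<in> nonfaces V L k. p \<notin> S} - nonfaces (V - {p}) (del p L) k. q \<notin> S}"
    (is "card ?A = card ?B")
proof (rule card_eq_if_relation_bijective[where r = "pivots L p q 1"])
  fix F assume "F \<in> ?A"
  then have F: "F \<subseteq> V" "card F = 2 * k" "free_in (del p L) F" "p \<notin> F" "q \<notin> F" "\<not> free_in L F"
    unfolding facets_def by auto
  have finF: "finite F" using F(1) finite_V finite_subset by blast
  have S: "insert p (insert q F) \<subseteq> V" "card (insert p (insert q F)) = 2 * k + 2"
    using F pq finF by auto
  obtain x where x: "x \<in> L" "supp x = insert p (insert q F)" "x p = 1"
    using circuit_ex[OF S, of p 1] by auto
  obtain y where y: "y \<in> L" "neg_part y \<subseteq> F" "y \<noteq> (\<lambda>_. 0)" using F(6) unfolding free_in_def by blast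
  have ypos: "0 \<le> y u" if "u \<notin> F" for u using neg_part_nonneg[OF y(2) that] .
  \<comment> \<open>The witness that \<open>F\<close> is not free in \<open>L\<close> must use
    \<open>p\<close>, and positively: \<open>F\<close> is visible from \<open>p\<close>.\<close>
  have "y p \<noteq> 0" using F(3) y unfolding free_in_def del_def by blast
  then have yp: "0 < y p" using ypos[OF F(4)] by simp
  have "0 < x q"
  proof (rule ccontr)
    assume "\<not> 0 < x q"
    moreover have "x q \<noteq> 0" using x(2) unfolding supp_def by blast
    ultimately have xq: "x q < 0" by simp
    define z where "z = (\<lambda>u. y u + (- y p) * x u)"
    have "z \<in> del p L" unfolding del_def
      using L_comb[OF y(1) x(1), of "- y p"] x(3) by (simp add: z_def)
    moreover have zq: "0 < z q" unfolding z_def using ypos[OF F(5)] mult_pos_neg[OF yp xq] by simp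
    moreover have "neg_part z \<subseteq> F"
    proof
      fix u assume u: "u \<in> neg_part z"
      show "u \<in> F"
      proof (rule ccontr)
        assume uF: "u \<notin> F"
        have "u \<noteq> p" using u x(3) unfolding neg_part_def z_def by auto
        moreover have "u \<noteq> q" using u zq unfolding neg_part_def by auto
        ultimately have "u \<notin> supp x" using uF x(2) by blast
        then show False using u ypos[OF uF] unfolding neg_part_def z_def supp_def by simp
      qed
    qed
    ultimately have "z = (\<lambda>_. 0)" using F(3) unfolding free_in_def by blast
    then show False using zq by simp
  qed
  then have r: "pivots L p q 1 F (neg_part x)" unfolding pivots_def using x by blast
  have nF: "neg_part x \<subseteq> F"
  proof
    fix u assume "u \<in> neg_part x"
    then have "u \<in> supp x" "u \<noteq> p" "u \<noteq> q"
      using x(3) \<open>0 < x q\<close> unfolding neg_part_def supp_def by auto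
    then show "u \<in> F" using x(2) by blast
  qed
  then have "free_in (del p L) (neg_part x)" using free_in_mono F(3) by blast
  then have "neg_part x \<in> ?B"
    using nonfaceI[OF x(1) pivots_neg_card[OF x(1,2) F(2) pq(3) F(4,5) finF]] nF F(4,5)
    unfolding nonfaces_def by auto
  then show "\<exists>!S. S \<in> ?B \<and> pivots L p q 1 F S"
    using r pivots_functional[OF _ r F(2) pq(3) F(4,5) finF] by blast
next
  fix S assume "S \<in> ?B"
  then have S: "S \<in> nonfaces V L k" "p \<notin> S" "q \<notin> S" "S \<notin> nonfaces (V - {p}) (del p L) k" by auto
  then have cS: "card S = k + 1" "S \<subseteq> V" "finite S"
    using finite_V finite_subset unfolding nonfaces_def by auto
  have R: "free_in (del p L) S" using S(2,4) cS unfolding nonfaces_def by auto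
  obtain x1 where x1: "x1 \<in> L" "x1 \<noteq> (\<lambda>_. 0)" "neg_part x1 = S" using nonface_witness[OF S(1)] by blast
  have x1pos: "0 \<le> x1 u" if "u \<notin> S" for u
    using x1(3) that unfolding neg_part_def by (metis (mono_tags) linorder_not_le mem_Collect_eq)
  have "x1 p \<noteq> 0" using R x1 unfolding free_in_def del_def by blast
  then have x1p: "0 < x1 p" using x1pos[OF S(2)] by simp
  define x0 where "x0 = (\<lambda>u. (1 / x1 p) * x1 u)"
  have x0: "x0 \<in> L" "x0 p = 1" unfolding x0_def by (rule L_scale[OF x1(1)], use x1p in simp)
  have x0pos: "0 \<le> x0 u" if "u \<notin> insert p S" for u
    unfolding x0_def using x1p x1pos[of u] that by simp
  obtain F x where F: "F \<subseteq> V - {p, q}" "card F = 2 * k" "free_in (del p L) F"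
    and x: "x \<in> L" "x p = 1" "0 < x q" "supp x = insert p (insert q F)"
      "\<And>u. u \<notin> insert p S \<Longrightarrow> 0 \<le> x u"
    using pivot[OF x0 x0pos _ pq S(2,3) R] by auto
  have "neg_part x \<subseteq> S"
  proof
    fix u assume u: "u \<in> neg_part x"
    then have "\<not> 0 \<le> x u" unfolding neg_part_def by simp
    moreover have "u \<noteq> p" using u x(2) unfolding neg_part_def by auto
    ultimately show "u \<in> S" using x(5)[of u] by auto
  qed
  then have nx: "neg_part x = S"
    using neg_eq[OF x(1) nonzeroI[of x p] _ cS(3)] x(2) cS(1) by simp
  then have r: "pivots L p q 1 F S" unfolding pivots_def using x by blast
  \<comment> \<open>\<open>S\<close> avoids \<open>p\<close> and \<open>q\<close>, so
    \<open>x\<close> itself witnesses that \<open>F\<close> is not free in \<open>L\<close>.\<close>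
  have "neg_part x \<subseteq> F" 
  proof
    fix u assume "u \<in> neg_part x"
    then have "u \<in> supp x" "u \<noteq> p" "u \<noteq> q"
      using nx S(2,3) neg_subset_supp[of x] by auto
    then show "u \<in> F" using x(4) by blast
  qed
  moreover have "x \<noteq> (\<lambda>_. 0)" using x(2) by auto
  ultimately have "\<not> free_in L F" using x(1) unfolding free_in_def by blast
  then have "F \<in> ?A" using F unfolding facets_def by auto
  moreover have "G = F" if "G \<in> ?A" "pivots L p q 1 G S" for G
  proof (rule pivots_unique[OF _ _ _ F(3) _ _ that(2) r])
    show "free_in (del p L) G" "p \<notin> G" "q \<notin> G"
      using that(1) unfolding facets_def by auto
  qed (use F in auto)
  ultimately show "\<exists>!F. F \<in> ?A \<and> pivots L p q 1 F S" using r by blast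
qed

end

section \<open>Double counting\<close>

lemma card_filter_split:
  assumes "finite A"
  shows "card {x \<in> A. P x} + card {x \<in> A. \<not> P x} = card A"
proof -
  have "card ({x \<in> A. P x} \<union> {x \<in> A. \<not> P x}) = card {x \<in> A. P x} + card {x \<in> A. \<not> P x}"
    using assms by (intro card_Un_disjoint) auto
  moreover have "{x \<in> A. P x} \<union> {x \<in> A. \<not> P x} = A" by auto
  ultimately show ?thesis by simp
qed

lemma card_diff_add:
  assumes "B \<subseteq> A" "finite A"
  shows "card (A - B) + card B = card A"
  using assms card_Diff_subset[of B A] card_mono[of A B] finite_subset[of B A] by simp

section \<open>Linear relations among the numbers of facets and nonfaces\<close>

context balanced_dependences
begin

lemma finite_nonfaces: "finite (nonfaces V L k)"
  using finite_V unfolding nonfaces_def by simp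

lemma finite_facets: "finite (facets V L k)"
  using finite_V unfolding facets_def by simp

text \<open>Sum \<open>card_facets_avoiding\<close> over all \<open>q\<close> other than
  \<open>p\<close>, and count for each facet or nonface the admissible \<open>q\<close>.\<close>

lemma card_facets_avoiding_vertex:
  assumes p: "p \<in> V"
  shows "(card V - 1 - 2 * k) * card {F \<in> facets V L k. p \<notin> F} =
    (card V - (k + 1)) * card {S \<in> nonfaces V L k. p \<in> S}"
proof -
  have "(\<Sum>q\<in>V - {p}. card {F \<in> {F \<in> facets V L k. p \<notin> F}. q \<notin> F}) =
      (card V - 1 - 2 * k) * card {F \<in> facets V L k. p \<notin> F}"
  proof (rule sum_card_avoiding)
    fix F assume "F \<in> {F \<in> facets V L k. p \<notin> F}"
    then have F: "F \<subseteq> V - {p}" "card F = 2 * k" unfolding facets_def by auto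
    then have "card (V - {p} - F) = card (V - {p}) - card F"
      using finite_V by (intro card_Diff_subset) (auto intro: finite_subset)
    then show "card (V - {p} - F) = card V - 1 - 2 * k" using F p by simp
  qed (use finite_V finite_facets in auto)
  moreover have "(\<Sum>q\<in>V - {p}. card {S \<in> {S \<in> nonfaces V L k. p \<in> S}. q \<notin> S}) =
      (card V - (k + 1)) * card {S \<in> nonfaces V L k. p \<in> S}"
  proof (rule sum_card_avoiding)
    fix S assume "S \<in> {S \<in> nonfaces V L k. p \<in> S}"
    then have S: "S \<subseteq> V" "card S = k + 1" "p \<in> S" unfolding nonfaces_def by auto
    then have "card (V - S) = card V - card S"
      using finite_V by (intro card_Diff_subset) (auto intro: finite_subset)
    moreover have "V - {p} - S = V - S" using S by auto
    ultimately show "card (V - {p} - S) = card V - (k + 1)" using S by simp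
  qed (use finite_V finite_nonfaces in auto)
  moreover have "card {F \<in> {F \<in> facets V L k. p \<notin> F}. q \<notin> F} =
      card {S \<in> {S \<in> nonfaces V L k. p \<in> S}. q \<notin> S}" if "q \<in> V - {p}" for q
    using card_facets_avoiding[OF p, of q] that by (simp add: conj_assoc neq_commute)
  ultimately show ?thesis by simp
qed

text \<open>The left side of \<open>card_facets_avoiding\<close> is symmetric in \<open>p\<close>
  and \<open>q\<close>, so as many nonfaces contain \<open>p\<close> without \<open>q\<close> as
  contain \<open>q\<close> without \<open>p\<close>.\<close>

lemma card_nonfaces_vertex_transitive:
  assumes "p \<in> V" "q \<in> V"
  shows "card {S \<in> nonfaces V L k. p \<in> S} = card {S \<in> nonfaces V L k. q \<in> S}"
proof (cases "p = q")
  case False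
  have fin: "finite {S \<in> nonfaces V L k. r \<in> S}" for r using finite_nonfaces by simp
  have "card {S \<in> nonfaces V L k. p \<in> S \<and> q \<notin> S} = card {S \<in> nonfaces V L k. q \<in> S \<and> p \<notin> S}"
    using card_facets_avoiding[OF assms False] card_facets_avoiding[OF assms(2,1)] False
    by (simp add: conj_commute)
  then show ?thesis
    using card_filter_split[OF fin[of p], of "\<lambda>S. q \<in> S"]
      card_filter_split[OF fin[of q], of "\<lambda>S. p \<in> S"]
    by (simp add: conj_commute conj_left_commute)
qed simp

text \<open>Incidences of vertices and nonfaces, counted with the constant vertex degree from
  \<open>card_nonfaces_vertex_transitive\<close>.\<close>

lemma card_nonfaces_through:
  assumes p: "p \<in> V"
  shows "card V * card {S \<in> nonfaces V L k. p \<in> S} = (k + 1) * card (nonfaces V L k)"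
proof -
  let ?N = "card (nonfaces V L k)" and ?Np = "card {S \<in> nonfaces V L k. p \<in> S}"
  have "(\<Sum>q\<in>V. card {S \<in> nonfaces V L k. q \<notin> S}) = (card V - (k + 1)) * ?N"
  proof (rule sum_card_avoiding)
    fix S assume "S \<in> nonfaces V L k"
    then have S: "S \<subseteq> V" "card S = k + 1" unfolding nonfaces_def by auto
    then have "card (V - S) = card V - card S"
      using finite_V by (intro card_Diff_subset) (auto intro: finite_subset)
    then show "card (V - S) = card V - (k + 1)" using S by simp
  qed (use finite_V finite_nonfaces in auto)
  moreover have "card {S \<in> nonfaces V L k. q \<notin> S} = ?N - ?Np" if "q \<in> V" for q
    using card_nonfaces_vertex_transitive[OF p that]
      card_filter_split[OF finite_nonfaces, of "\<lambda>S. q \<in> S"] by simp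
  ultimately have eq: "card V * (?N - ?Np) = (card V - (k + 1)) * ?N" by simp
  have le: "?Np \<le> ?N" by (intro card_mono finite_nonfaces) auto
  show ?thesis
  proof (cases "k + 1 \<le> card V")
    case True
    have "int (card V) * (int ?N - int ?Np) = (int (card V) - int (k + 1)) * int ?N"
      using arg_cong[OF eq, of int] True le by (simp add: of_nat_diff)
    then have "int (card V) * int ?Np = int (k + 1) * int ?N" by (simp add: algebra_simps)
    then show ?thesis unfolding of_nat_mult[symmetric] of_nat_eq_iff .
  next
    case False
    have "\<not> (S \<subseteq> V \<and> card S = k + 1)" for S using False card_mono[OF finite_V, of S] by auto
    then have "nonfaces V L k = {}" unfolding nonfaces_def by blast
    then show ?thesis by simp
  qed
qed

text \<open>Sum \<open>card_facets_avoiding_vertex\<close> over \<open>p\<close>; the right-hand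
  sides all agree.\<close>

lemma card_facets:
  shows "(card V - 1 - 2 * k) * (card V - 2 * k) * card (facets V L k) =
    (card V - (k + 1)) * (k + 1) * card (nonfaces V L k)"
proof (cases "V = {}")
  case True
  have "nonfaces V L k = {}" unfolding nonfaces_def using True by auto
  then show ?thesis using True by simp
next
  case False
  then obtain r where r: "r \<in> V" by blast
  have sum: "(\<Sum>p\<in>V. card {F \<in> facets V L k. p \<notin> F}) = (card V - 2 * k) * card (facets V L k)"
  proof (rule sum_card_avoiding)
    fix S assume "S \<in> facets V L k"
    then have S: "S \<subseteq> V" "card S = 2 * k" unfolding facets_def by auto
    then have "card (V - S) = card V - card S"
      using finite_V by (intro card_Diff_subset) (auto intro: finite_subset)
    then show "card (V - S) = card V - 2 * k" using S by simp
  qed (use finite_V finite_facets in auto)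
  have "(card V - 1 - 2 * k) * (card V - 2 * k) * card (facets V L k) =
      (\<Sum>p\<in>V. (card V - 1 - 2 * k) * card {F \<in> facets V L k. p \<notin> F})"
    unfolding mult.assoc sum[symmetric] by (simp add: sum_distrib_left)
  also have "\<dots> = (\<Sum>p\<in>V. (card V - (k + 1)) * card {S \<in> nonfaces V L k. r \<in> S})"
    using card_facets_avoiding_vertex card_nonfaces_vertex_transitive[OF r] by (intro sum.cong) auto
  also have "\<dots> = (card V - (k + 1)) * (card V * card {S \<in> nonfaces V L k. r \<in> S})" by simp
  also have "\<dots> = (card V - (k + 1)) * (k + 1) * card (nonfaces V L k)"
    unfolding card_nonfaces_through[OF r] by (simp only: mult.assoc)
  finally show ?thesis .
qed

text \<open>Sum \<open>card_visible_facets_avoiding\<close> over \<open>q\<close>: the nonfaces lost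
  with \<open>p\<close> against the facets visible from \<open>p\<close>.\<close>

lemma card_new_nonfaces:
  assumes p: "p \<in> V"
  shows "(card V - 1 - (k + 1)) *
      card ({S \<in> nonfaces V L k. p \<notin> S} - nonfaces (V - {p}) (del p L) k) =
    (card V - 1 - 2 * k) * card (facets (V - {p}) (del p L) k - facets V L k)"
    (is "_ * card ?M = _ * card ?B")
proof -
  have "(\<Sum>q\<in>V - {p}. card {S \<in> ?M. q \<notin> S}) = (card V - 1 - (k + 1)) * card ?M"
  proof (rule sum_card_avoiding)
    fix S assume "S \<in> ?M"
    then have S: "S \<subseteq> V - {p}" "card S = k + 1" unfolding nonfaces_def by auto
    then have "card (V - {p} - S) = card (V - {p}) - card S"
      using finite_V by (intro card_Diff_subset) (auto intro: finite_subset)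
    then show "card (V - {p} - S) = card V - 1 - (k + 1)" using S p by simp
  qed (use finite_V finite_nonfaces in auto)
  moreover have "(\<Sum>q\<in>V - {p}. card {F \<in> ?B. q \<notin> F}) = (card V - 1 - 2 * k) * card ?B"
  proof (rule sum_card_avoiding)
    fix S assume "S \<in> ?B"
    then have S: "S \<subseteq> V - {p}" "card S = 2 * k" unfolding facets_def by auto
    then have "card (V - {p} - S) = card (V - {p}) - card S"
      using finite_V by (intro card_Diff_subset) (auto intro: finite_subset)
    then show "card (V - {p} - S) = card V - 1 - 2 * k" using S p by simp
  qed (use finite_V in \<open>auto simp: facets_def\<close>)
  moreover have "card {S \<in> ?M. q \<notin> S} = card {F \<in> ?B. q \<notin> F}" if "q \<in> V - {p}" for q
  proof -
    have "q \<in> V" "p \<noteq> q" using that by auto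
    then show ?thesis by (rule card_visible_facets_avoiding[OF p, symmetric])
  qed
  then have "(\<Sum>q\<in>V - {p}. card {S \<in> ?M. q \<notin> S}) = (\<Sum>q\<in>V - {p}. card {F \<in> ?B. q \<notin> F})"
    by (rule sum.cong[OF refl])
  ultimately show ?thesis by (simp only:)
qed

lemma card_new_nonfaces_eq:
  assumes p: "p \<in> V"
  shows "card ({S \<in> nonfaces V L k. p \<notin> S} - nonfaces (V - {p}) (del p L) k)
      + card {S \<in> nonfaces V L k. p \<in> S} + card (nonfaces (V - {p}) (del p L) k)
    = card (nonfaces V L k)"
proof -
  have "nonfaces (V - {p}) (del p L) k \<subseteq> {S \<in> nonfaces V L k. p \<notin> S}"
    using free_in_del[of L _ p] by (auto simp: nonfaces_def)
  moreover have fin: "finite {S \<in> nonfaces V L k. p \<notin> S}" using finite_nonfaces by simp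
  ultimately have "card ({S \<in> nonfaces V L k. p \<notin> S} - nonfaces (V - {p}) (del p L) k) +
      card (nonfaces (V - {p}) (del p L) k) = card {S \<in> nonfaces V L k. p \<notin> S}"
    by (simp add: card_diff_add)
  then show ?thesis using card_filter_split[OF finite_nonfaces, of "\<lambda>S. p \<in> S"] by simp
qed

lemma card_visible_facets_eq:
  assumes p: "p \<in> V"
  shows "card (facets (V - {p}) (del p L) k - facets V L k) + card {F \<in> facets V L k. p \<notin> F} =
    card (facets (V - {p}) (del p L) k)"
proof -
  have sub: "{F \<in> facets V L k. p \<notin> F} \<subseteq> facets (V - {p}) (del p L) k"
    using free_in_del[of L _ p] by (auto simp: facets_def)
  have "facets (V - {p}) (del p L) k - facets V L k =
      facets (V - {p}) (del p L) k - {F \<in> facets V L k. p \<notin> F}"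
    unfolding facets_def by auto
  moreover have "finite (facets (V - {p}) (del p L) k)" unfolding facets_def using finite_V by simp
  ultimately show ?thesis using sub
    by (simp add: card_diff_add)
qed

text \<open>\<open>2 * k + 1\<close> vertices cannot carry a nonzero dependence; this starts the
  induction.\<close>

lemma simplex_faces:
  assumes "card V = 2 * k + 1"
  shows "nonfaces V L k = {}" "card (facets V L k) = 2 * k + 1"
proof -
  have "free_in L S" for S
    unfolding free_in_def
  proof (intro ballI impI, rule ccontr)
    fix x assume x: "x \<in> L" "x \<noteq> (\<lambda>_. 0)"
    have "card (supp x) \<le> card V" by (intro card_mono supp_subset x finite_V)
    then show False using balanced(1)[OF x] assms by simp
  qed
  then show "nonfaces V L k = {}" "card (facets V L k) = 2 * k + 1"
    unfolding nonfaces_def facets_def using n_subsets[OF finite_V, of "2 * k"] assms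
    by (auto simp: binomial_symmetric[of "2 * k" "2 * k + 1"])
qed

end

text \<open>Delete a vertex \<open>p\<close> and eliminate from the counting relations everything
  except \<open>N\<close> and the numbers \<open>N'\<close> and \<open>F'\<close> of the deletion.
  Then \<open>F'\<close> is known from \<open>N'\<close> through \<open>card_facets\<close>, and
  \<open>N'\<close> from the induction hypothesis.\<close>

lemma card_nonfaces:
  assumes "balanced_dependences V L k" "card V = 2 * k + 1 + j" "1 \<le> k"
  shows "(k + 1) * card (nonfaces V L k) = card V * ((card V - k - 2) choose k)"
  using assms(1,2)
proof (induction j arbitrary: V L)
  case (0 V L)
  interpret balanced_dependences V L k by fact
  have "(card V - k - 2) choose k = 0" using 0 assms(3) by (intro binomial_eq_0) simp
  then show ?case using simplex_faces(1) 0 by simp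
next
  case (Suc j V L)
  interpret balanced_dependences V L k by fact
  obtain p where p: "p \<in> V" using Suc.prems(2) by fastforce
  interpret D: balanced_dependences "V - {p}" "del p L" k
    using p by (rule balanced_dependences_del)
  define m where "m = 2 * k + 1 + j"
  have j: "m = 2 * k + 1 + j" by (rule m_def)
  have cD: "card (V - {p}) = m" using p Suc.prems(2) finite_V unfolding m_def by simp
  have n: "card V = 2 * k + 2 + j" using Suc.prems(2) by simp
  define N Np N' F' Fp M B where "N = real (card (nonfaces V L k))"
    and "Np = real (card {S \<in> nonfaces V L k. p \<in> S})"
    and "N' = real (card (nonfaces (V - {p}) (del p L) k))"
    and "F' = real (card (facets (V - {p}) (del p L) k))"
    and "Fp = real (card {F \<in> facets V L k. p \<notin> F})"
    and "M = real (card ({S \<in> nonfaces V L k. p \<notin> S} - nonfaces (V - {p}) (del p L) k))"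
    and "B = real (card (facets (V - {p}) (del p L) k - facets V L k))"
  note defs = N_def Np_def N'_def F'_def Fp_def M_def B_def
  define c d where "c = real k" and "d = real j"
  have nonneg: "0 < c" "0 \<le> d" using assms(3) unfolding c_def d_def by auto
  have e1: "(2 * c + 2 + d) * Np = (c + 1) * N"
    using arg_cong[OF card_nonfaces_through[OF p], of real] unfolding defs c_def d_def n
    by (simp add: algebra_simps)
  have e2: "(1 + d) * Fp = (c + 1 + d) * Np"
    using arg_cong[OF card_facets_avoiding_vertex[OF p], of real] unfolding defs c_def d_def n
    by (simp add: algebra_simps)
  have e3: "(c + d) * M = (1 + d) * B"
    using arg_cong[OF card_new_nonfaces[OF p], of real] unfolding defs c_def d_def n
    by (simp add: algebra_simps)
  have e4: "M + Np + N' = N"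
    using arg_cong[OF card_new_nonfaces_eq[OF p], of real] unfolding defs by simp
  have e5: "B + Fp = F'"
    using arg_cong[OF card_visible_facets_eq[OF p], of real] unfolding defs by simp
  have main: "(c + 1 + d) * (2 * c + 1 + d) * N = (2 * c + 2 + d) * ((1 + d) * F' + (c + d) * N')"
  proof -
    have h: "(1 + d) * F' = (c + d) * (N - Np - N') + (c + 1 + d) * Np"
    proof -
      have "M = N - Np - N'" "B = F' - Fp" using e4 e5 by simp_all
      then have "(c + d) * (N - Np - N') = (1 + d) * (F' - Fp)" using e3 by simp
      then show ?thesis using e2 by (simp add: algebra_simps)
    qed
    have "(2 * c + 2 + d) * ((1 + d) * F' + (c + d) * N') =
        (c + d) * (2 * c + 2 + d) * N + (2 * c + 2 + d) * Np"
      unfolding h by (simp add: algebra_simps)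
    also have "\<dots> = (c + 1 + d) * (2 * c + 1 + d) * N"
      unfolding e1 by (simp add: algebra_simps)
    finally show ?thesis by simp
  qed
  have pos: "c + 1 + d > 0" "2 * c + 1 + d > 0" using nonneg by simp_all
  show ?case
  \<comment> \<open>For \<open>j = 0\<close> the deletion is a simplex, where
    \<open>card_facets\<close> reads \<open>0 = 0\<close>; its facet number is inserted
    directly.\<close>
  proof (cases j)
    case 0
    then have "N' = 0" "F' = 2 * c + 1"
      using D.simplex_faces cD j unfolding N'_def F'_def c_def by simp_all
    then have "((c + 1) * (2 * c + 1)) * N = ((c + 1) * (2 * c + 1)) * 2"
      using main 0 unfolding d_def by (simp add: algebra_simps)
    moreover have "(c + 1) * (2 * c + 1) \<noteq> 0" using nonneg by simp
    ultimately have "N = 2" by (metis mult_left_cancel)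
    then have "card (nonfaces V L k) = 2" unfolding N_def by linarith
    then show ?thesis using n 0 by simp
  next
    case j_Suc: (Suc i)
    have IH: "(k + 1) * card (nonfaces (V - {p}) (del p L) k) = m * ((m - k - 2) choose k)"
      using Suc.IH[OF D.balanced_dependences_axioms] cD j by simp
    define b where "b = real ((m - k - 2) choose k)"
    have IH': "(c + 1) * N' = (2 * c + 1 + d) * b"
      using arg_cong[OF IH, of real] unfolding N'_def b_def c_def d_def j
      by (simp add: algebra_simps)
    have "d * ((1 + d) * F') = (c + d) * ((c + 1) * N')"
      using arg_cong[OF D.card_facets, of real] unfolding cD defs c_def d_def j j_Suc
      by (simp add: algebra_simps)
    moreover have "d * ((c + 1 + d) * (2 * c + 1 + d) * N) =
        (2 * c + 2 + d) * (d * ((1 + d) * F') + (c + d) * d * N')"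
      unfolding main by (simp add: algebra_simps)
    ultimately have "d * ((c + 1 + d) * (2 * c + 1 + d) * N) =
        (2 * c + 2 + d) * (c + d) * (c + 1 + d) * N'"
      by (simp add: algebra_simps)
    then have "(c + 1 + d) * (d * (2 * c + 1 + d) * N - (2 * c + 2 + d) * (c + d) * N') = 0"
      by (simp add: algebra_simps)
    then have "d * (2 * c + 1 + d) * N = (2 * c + 2 + d) * (c + d) * N'" using pos by simp
    then have "(c + 1) * (d * (2 * c + 1 + d) * N) = (c + 1) * ((2 * c + 2 + d) * (c + d) * N')"
      by (simp only:)
    then have "d * (2 * c + 1 + d) * ((c + 1) * N) = (2 * c + 2 + d) * (c + d) * ((c + 1) * N')"
      by (simp only: mult_ac)
    then have "(2 * c + 1 + d) * (d * ((c + 1) * N) - (2 * c + 2 + d) * (c + d) * b) = 0"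
      unfolding IH' by (simp add: algebra_simps)
    then have a: "d * ((c + 1) * N) = (2 * c + 2 + d) * ((c + d) * b)" using pos by simp
    have idx: "card V - k - 2 = Suc (m - k - 2)" "Suc (m - k - 2) = k + j"
      using n j j_Suc by simp_all
    \<comment> \<open>Absorption, \<open>(r - k) * (r choose k) = r * (r - 1 choose k)\<close> with
      \<open>r = k + j\<close>: the step from \<open>m\<close> to \<open>m + 1\<close> vertices on
      the side of the closed form.\<close>
    have "(Suc (m - k - 2) - k) * (Suc (m - k - 2) choose k) = Suc (m - k - 2) * ((m - k - 2) choose k)"
      using binomial_absorb_comp[of "Suc (m - k - 2)" k] by simp
    then have "j * ((card V - k - 2) choose k) = (k + j) * ((m - k - 2) choose k)"
      unfolding idx by simp
    then have b: "d * real ((card V - k - 2) choose k) = (c + d) * b"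
      unfolding b_def c_def d_def by (metis of_nat_add of_nat_mult)
    have "d * ((c + 1) * N) = d * ((2 * c + 2 + d) * real ((card V - k - 2) choose k))"
      unfolding a b[symmetric] by (simp only: mult_ac)
    moreover have "d \<noteq> 0" unfolding d_def j_Suc by simp
    ultimately have "(c + 1) * N = (2 * c + 2 + d) * real ((card V - k - 2) choose k)" by simp
    then have "real ((k + 1) * card (nonfaces V L k)) = real (card V * ((card V - k - 2) choose k))"
      unfolding N_def c_def d_def n by (simp add: algebra_simps)
    then show ?thesis by (rule of_nat_eq_iff[THEN iffD1])
  qed
qed

section \<open>Nonfaces destroyed by deleting a vertex\<close>

context balanced_dependences
begin

lemma card_nonfaces_only_with:
  assumes "p \<in> V" "1 \<le> k" "2 * k + 2 \<le> card V"
  shows "card ({S \<in> nonfaces V L k. p \<notin> S} - nonfaces (V - {p}) (del p L) k) =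
    (card V - k - 3) choose (k - 1)"
proof -
  obtain j where j: "card V = 2 * k + 2 + j" using assms(3) le_Suc_ex by blast
  obtain i where i: "k = Suc i" using assms(2) by (cases k) auto
  interpret D: balanced_dependences "V - {p}" "del p L" k
    using assms(1) by (rule balanced_dependences_del)
  have cD: "card (V - {p}) = 2 * k + 1 + j" using assms(1) finite_V j by simp
  \<comment> \<open>\<open>a\<close> is \<open>card V - k - 3\<close>; the closed forms for
    \<open>V\<close> and for the deletion involve \<open>Suc a choose k\<close> and
    \<open>a choose k\<close>.\<close>
  define a M where "a = k + j - 1"
    and "M = card ({S \<in> nonfaces V L k. p \<notin> S} - nonfaces (V - {p}) (del p L) k)"
  have N: "(k + 1) * card (nonfaces V L k) = (2 * k + 2 + j) * (Suc a choose k)"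
    using card_nonfaces[OF balanced_dependences_axioms _ assms(2), of "Suc j"] assms(2)
    unfolding j a_def by simp
  have N': "(k + 1) * card (nonfaces (V - {p}) (del p L) k) = (2 * k + 1 + j) * (a choose k)"
    using card_nonfaces[OF D.balanced_dependences_axioms cD assms(2)] unfolding cD a_def by simp
  have "(2 * k + 2 + j) * card {S \<in> nonfaces V L k. p \<in> S} = (2 * k + 2 + j) * (Suc a choose k)"
    using card_nonfaces_through[OF assms(1)] N unfolding j by simp
  then have Np: "card {S \<in> nonfaces V L k. p \<in> S} = Suc a choose k"
    by (simp only: mult_cancel1) simp
  have "(k + 1) * M + (k + 1) * (Suc a choose k) + (2 * k + 1 + j) * (a choose k) =
      (2 * k + 2 + j) * (Suc a choose k)"
    using arg_cong[OF card_new_nonfaces_eq[OF assms(1)], of "\<lambda>x. (k + 1) * x"]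
    unfolding M_def[symmetric] Np distrib_left N N' by simp
  then have "(k + 1) * M + (2 * k + 1 + j) * (a choose k) = (k + 1 + j) * (Suc a choose k)"
    by (simp add: algebra_simps)
  \<comment> \<open>Pascal's rule and absorption, with \<open>a - (k - 1) = j\<close>, express
    everything through \<open>a choose (k - 1)\<close>.\<close>
  moreover have "Suc a choose k = (a choose i) + (a choose k)" unfolding i by simp
  ultimately have "(k + 1) * M + k * (a choose k) = (k + 1 + j) * (a choose i)"
    by (simp add: algebra_simps)
  moreover have "k * (a choose k) = j * (a choose i)"
  proof -
    have "Suc i * (a choose Suc i) = (a - i) * (a choose i)"
      using binomial_absorption[of i a] binomial_absorb_comp[of a i] by (cases a) (simp_all)
    moreover have "a - i = j" unfolding a_def i by simp
    ultimately show ?thesis unfolding i by simp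
  qed
  ultimately have "(k + 1) * M = (k + 1) * (a choose i)" by (simp add: algebra_simps)
  then have "M = a choose i" by (simp only: mult_cancel1) simp
  then show ?thesis unfolding M_def a_def j i by simp
qed

end

section \<open>Missing faces of a link\<close>

context balanced_dependences
begin

lemma free_in_small:
  assumes "finite S" "card S \<le> k"
  shows "free_in L S"
  unfolding free_in_def
proof (intro ballI impI, rule ccontr)
  fix x assume x: "x \<in> L" "neg_part x \<subseteq> S" "x \<noteq> (\<lambda>_. 0)"
  show False using neg_card[OF x(1,3)] card_mono[OF assms(1) x(2)] assms(2) by simp
qed

lemma not_free_inE:
  assumes "\<not> free_in L S"
  obtains x where "x \<in> L" "x \<noteq> (\<lambda>_. 0)" "neg_part x \<subseteq> S"
  using assms unfolding free_in_def by blast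

text \<open>A dependence \<open>y\<close> negative only on \<open>insert p T\<close> and one
  \<open>x\<close> with negative part \<open>S\<close> have opposite signs at \<open>p\<close>.
  Their positive combination that vanishes at \<open>p\<close> is negative only in \<open>S\<close>,
  against the freeness of \<open>S\<close> in the deletion.\<close>

lemma free_in_cone_if:
  assumes k: "1 \<le> k" and p: "p \<in> V" "p \<notin> S"
    and S: "S \<in> nonfaces V L k" "free_in (del p L) S" and T: "T \<subset> S"
  shows "free_in L (insert p T)"
proof (rule ccontr)
  assume "\<not> free_in L (insert p T)"
  then obtain y where y: "y \<in> L" "y \<noteq> (\<lambda>_. 0)" "neg_part y \<subseteq> insert p T" by (rule not_free_inE)
  have cS: "card S = k + 1" "finite S"
    using S(1) finite_V finite_subset unfolding nonfaces_def by auto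
  have cT: "card T < k + 1" "finite T"
    using psubset_card_mono[OF cS(2) T] cS T finite_subset by auto
  have "p \<notin> T" using T p by blast
  then have pT: "card (insert p T) = card T + 1" using cT by simp
  have neg_y: "neg_part y = insert p T" using neg_eq[OF y] cT pT by simp
  \<comment> \<open>\<open>T\<close> has exactly \<open>k\<close> elements and \<open>k\<close> is
    positive, so there is a common negative coordinate \<open>a\<close>, which keeps the combination
    nonzero.\<close>
  then have "card T = k" using neg_card[OF y(1,2)] pT cT by simp
  then have "T \<noteq> {}" using k by auto
  then obtain a where a: "a \<in> T" by blast
  obtain x where x: "x \<in> L" "x \<noteq> (\<lambda>_. 0)" "neg_part x = S" using nonface_witness[OF S(1)] by blast
  have xpos: "0 \<le> x u" if "u \<notin> S" for u using neg_part_nonneg[of x S u] x(3) that by simp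
  have "x p \<noteq> 0" using S(2) x unfolding free_in_def del_def by blast
  then have xp: "0 < x p" using xpos[OF p(2)] by simp
  have "p \<in> neg_part y" "a \<in> neg_part y" "a \<in> neg_part x" using neg_y a T x(3) by auto
  then have yp: "y p < 0" and ya: "y a < 0" and xa: "x a < 0" unfolding neg_part_def by auto
  define z where "z = (\<lambda>u. x p * y u + (- y p) * x u)"
  have "z \<in> del p L"
    unfolding del_def using L_comb[OF L_scale[OF y(1)] x(1), of "x p" "- y p"] by (simp add: z_def)
  moreover have "neg_part z \<subseteq> S"
  proof
    fix u assume u: "u \<in> neg_part z"
    show "u \<in> S"
    proof (rule ccontr)
      assume uS: "u \<notin> S"
      have "u \<noteq> p" using u unfolding neg_part_def z_def by auto
      then have "u \<notin> neg_part y" using neg_y T uS by auto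
      then have "0 \<le> y u" unfolding neg_part_def by simp
      then have "0 \<le> x p * y u" "0 \<le> (- y p) * x u" using xp yp xpos[OF uS]
        by (intro mult_nonneg_nonneg; simp)+
      then show False using u unfolding neg_part_def z_def by simp
    qed
  qed
  ultimately have "z = (\<lambda>_. 0)" using S(2) unfolding free_in_def by blast
  then have "z a = 0" by simp
  moreover have "x p * y a < 0" using xp ya by (rule mult_pos_neg)
  moreover have "(- y p) * x a < 0" using yp xa by (intro mult_pos_neg) auto
  ultimately show False unfolding z_def by linarith
qed

text \<open>If \<open>S\<close> were free, a pivot over \<open>R = S\<close> would turn a dependence
  negative only in \<open>insert p S\<close> into a circuit with exactly \<open>k + 1\<close>
  negative coefficients, \<open>p\<close> among them. Only \<open>k\<close> of these lie in
  \<open>S\<close>, so the cone over a proper subset of \<open>S\<close> would already fail to be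
  free.\<close>

lemma nonface_if_cone_missing:
  assumes p: "p \<in> V" "p \<notin> S" and S: "S \<subseteq> V" "card S = k + 1" and V: "k + 3 \<le> card V"
    and cone: "\<not> free_in L (insert p S)" "\<And>T. T \<subset> S \<Longrightarrow> free_in L (insert p T)"
  shows "S \<in> nonfaces V L k"
proof (rule ccontr)
  assume "S \<notin> nonfaces V L k"
  then have free: "free_in L S" using S unfolding nonfaces_def by simp
  have finS: "finite S" using S(1) finite_V finite_subset by blast
  \<comment> \<open>The pivot requires a vertex \<open>q\<close> outside \<open>insert p S\<close>,
    which has \<open>k + 2\<close> elements.\<close>
  have "card (insert p S) < card V" using S(2) p(2) V finS by simp
  moreover have "insert p S \<subseteq> V" using p(1) S(1) by blast
  ultimately have "insert p S \<noteq> V" by blast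
  then obtain q where q: "q \<in> V" "p \<noteq> q" "q \<notin> S" using \<open>insert p S \<subseteq> V\<close> by blast
  obtain x where x: "x \<in> L" "x \<noteq> (\<lambda>_. 0)" "neg_part x \<subseteq> insert p S"
    using cone(1) by (rule not_free_inE)
  have "p \<in> neg_part x" using free x unfolding free_in_def by blast
  then have xp: "x p < 0" unfolding neg_part_def by simp
  have xpos: "0 \<le> x u" if "u \<notin> insert p S" for u using neg_part_nonneg[OF x(3) that] .
  have "x p \<noteq> 0" using xp by simp
  from pivot[OF x(1) refl xpos this p(1) q(1,2) p(2) q(3) free_in_del[OF free]]
  obtain F y where y: "F \<subseteq> V - {p, q}" "card F = 2 * k" "y \<in> L" "y p = x p"
      "supp y = insert p (insert q F)" "\<And>u. u \<notin> insert p S \<Longrightarrow> 0 \<le> y u"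
    by metis
  have "finite F" using y(1) finite_V finite_subset by blast
  then have cy: "card (neg_part y) = k + 1" using pivots_neg_card[OF y(3,5,2) q(2)] y(1) by blast
  have "neg_part y \<subseteq> insert p S"
  proof
    fix u assume "u \<in> neg_part y"
    then have "\<not> 0 \<le> y u" unfolding neg_part_def by simp
    then show "u \<in> insert p S" using y(6)[of u] by blast
  qed
  moreover have py: "p \<in> neg_part y" using y(4) xp unfolding neg_part_def by simp
  ultimately have "neg_part y - {p} \<subseteq> S" by blast
  moreover have "card (neg_part y - {p}) = k" using cy py by simp
  ultimately have "neg_part y - {p} \<subset> S" using S(2) by auto
  then have "free_in L (insert p (neg_part y - {p}))" by (rule cone(2))
  then have "free_in L (neg_part y)" using py by (simp add: insert_absorb)
  then have "y = (\<lambda>_. 0)" using y(3) unfolding free_in_def by blast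
  then show False using y(4) xp by simp
qed

text \<open>Otherwise take a circuit \<open>m\<close> of the deletion with negative part \<open>S\<close> and move it along a circuit \<open>c\<close>
  with \<open>c p < 0\<close> on the support of \<open>m\<close>: balancedness forces the first vanishing coefficient into \<open>S\<close>.\<close>

lemma nonface_not_in_deletion_if_cone_missing:
  assumes p: "p \<in> V" "p \<notin> S" and S: "S \<subseteq> V" "card S = k + 1" and V: "k + 3 \<le> card V"
    and cone: "\<And>T. T \<subset> S \<Longrightarrow> free_in L (insert p T)"
  shows "free_in (del p L) S"
proof (rule ccontr)
  assume nf: "\<not> free_in (del p L) S"
  interpret D: balanced_dependences "V - {p}" "del p L" k
    using p(1) by (rule balanced_dependences_del)
  have finS: "finite S" using S(1) finite_V finite_subset by blast
  have SD: "S \<in> nonfaces (V - {p}) (del p L) k" using nf S p unfolding nonfaces_def by auto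
  obtain m0 where m0: "m0 \<in> del p L" "neg_part m0 = S" using D.nonface_witness[OF SD] by blast
  obtain a where a: "a \<in> S" using S(2) by fastforce
  have "card (insert p S) < card V" using S(2) p(2) V finS by simp
  moreover have "insert p S \<subseteq> V" using p(1) S(1) by blast
  ultimately have "insert p S \<noteq> V" by blast
  then obtain q where q: "q \<in> V - {p}" "q \<notin> S" using \<open>insert p S \<subseteq> V\<close> by blast
  have aq: "a \<in> V - {p}" "a \<noteq> q" using a q S(1) p(2) by auto
  have m0a: "m0 a < 0" using a m0(2) unfolding neg_part_def by blast
  have m0pos: "0 \<le> m0 u" if "u \<notin> insert a (S - {a})" for u
    using neg_part_nonneg[of m0 S u] m0(2) that a by auto
  have "card (S - {a}) \<le> k" using S(2) a finS by simp
  then have "free_in (del p L) (S - {a})" by (intro D.free_in_small) (use finS in auto)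
  then have R: "free_in (del a (del p L)) (S - {a})" by (rule free_in_del)
  have "m0 a \<noteq> 0" "a \<notin> S - {a}" "q \<notin> S - {a}" using m0a q(2) by auto
  \<comment> \<open>Pivoting in the deletion replaces \<open>m0\<close> by a circuit
    \<open>m\<close> with the same negative part \<open>S\<close>.\<close>
  from D.pivot[OF m0(1) refl m0pos this(1) aq(1) q(1) aq(2) this(2,3) R]
  obtain F m where F: "F \<subseteq> V - {p} - {a, q}" "card F = 2 * k" and m: "m \<in> del p L" "m a = m0 a"
      "supp m = insert a (insert q F)" "\<And>u. u \<notin> insert a (S - {a}) \<Longrightarrow> 0 \<le> m u"
    by metis
  have finF: "finite F" using F(1) finite_V finite_subset by blast
  have mL: "m \<in> L" "m \<noteq> (\<lambda>_. 0)" using m(1,2) m0a unfolding del_def by auto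
  have "neg_part m \<subseteq> S"
  proof
    fix u assume "u \<in> neg_part m"
    then have "\<not> 0 \<le> m u" unfolding neg_part_def by simp
    then show "u \<in> S" using m(4)[of u] a by blast
  qed
  then have neg_m: "neg_part m = S" using neg_eq[OF mL _ finS] S(2) by simp
  define T where "T = supp m"
  have "a \<notin> insert q F" "q \<notin> F" using F(1) aq(2) by auto
  then have "card (insert a (insert q F)) = 2 * k + 2" using finF F(2) by simp
  then have T: "T \<subseteq> V - {p}" "card T = 2 * k + 2" "a \<in> T" "finite T"
    unfolding T_def using D.supp_subset[OF m(1)] finite_supp[OF mL(1)] m(3) by simp_all
  have ST: "S \<subseteq> T" unfolding T_def neg_m[symmetric] by (rule neg_subset_supp)
  \<comment> \<open>The circuit \<open>c\<close> lives on \<open>T\<close> with \<open>a\<close>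
    exchanged for \<open>p\<close>, so that moving along it makes the coefficient of
    \<open>p\<close> negative.\<close>
  have "p \<notin> T - {a}" "insert p (T - {a}) \<subseteq> V" using T(1) p(1) by auto
  moreover from this have "card (insert p (T - {a})) = 2 * k + 2" using T by simp
  ultimately  obtain c where c: "c \<in> L" "supp c = insert p (T - {a})" "c p = -1"
    using circuit_ex[of "insert p (T - {a})" p "-1"] by auto
  have mT: "m u \<noteq> 0 \<longleftrightarrow> u \<in> T" for u unfolding T_def supp_def by simp
  have mS: "m u < 0 \<longleftrightarrow> u \<in> S" for u using neg_m unfolding neg_part_def by blast
  have cT: "c u = 0" if "u \<notin> T" "u \<noteq> p" for u
    using c(2) that unfolding supp_def by blast
  have ca: "c a = 0"
  proof -
    have "a \<notin> supp c" using c(2) T(1,3) by auto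
    then show ?thesis unfolding supp_def by simp
  qed
  \<comment> \<open>On \<open>T\<close>, \<open>m u + t * c u = m u * (1 - t * r u)\<close>: if the
    largest ratio \<open>r b\<close> is positive, the coefficient of \<open>b\<close> is among the
    first to vanish, at \<open>t = 1 / r b\<close>.\<close>
  define r where "r u = - c u / m u" for u
  have cr: "c u = - r u * m u" if "u \<in> T" for u using mT[of u] that unfolding r_def by simp
  obtain b where b: "b \<in> T" "\<And>u. u \<in> T \<Longrightarrow> r u \<le> r b"
    using finite_max[OF T(4), of r] T(3) by blast
  \<comment> \<open>The hypothesis on cones: no dependence is negative at \<open>p\<close> and
    otherwise only on a proper part of \<open>S\<close>.\<close>
  have no_cone: "\<not> neg_part y \<subseteq> insert p (S - {u})" if "y \<in> L" "y p < 0" "u \<in> S" for y u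
  proof
    assume "neg_part y \<subseteq> insert p (S - {u})"
    moreover have "free_in L (insert p (S - {u}))" using that(3) by (intro cone) auto
    ultimately have "y = (\<lambda>_. 0)" using that(1) unfolding free_in_def by blast
    then show False using that(2) by simp
  qed
  show False
  proof (cases "r b \<le> 0")
    \<comment> \<open>No coefficient on \<open>T\<close> ever vanishes; then \<open>c\<close>
      itself, which is zero at \<open>a\<close>, contradicts the hypothesis on cones.\<close>
    case True
    have "neg_part c \<subseteq> insert p (S - {a})"
    proof
      fix u assume "u \<in> neg_part c"
      then have cu: "c u < 0" unfolding neg_part_def by simp
      show "u \<in> insert p (S - {a})"
      proof (rule ccontr)
        assume u: "u \<notin> insert p (S - {a})"
        then have "u \<in> T" using cT[of u] cu by auto
        moreover have "u \<noteq> a" using ca cu by auto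
        ultimately have "0 < m u" using mT[of u] mS[of u] u by auto
        moreover have "r u \<le> 0" using b(2)[OF \<open>u \<in> T\<close>] True by simp
        ultimately have "0 \<le> - r u * m u" by (intro mult_nonneg_nonneg) simp_all
        then show False using cr[OF \<open>u \<in> T\<close>] cu by simp
      qed
    qed
    then show False using no_cone[OF c(1) _ a] c(3) by simp
  next
    case False
    define y where "y = (\<lambda>u. m u + 1 / r b * c u)"
    have y: "y \<in> L" unfolding y_def by (rule L_comb[OF mL(1) c(1)])
    have "m p = 0" using mT[of p] T(1) by blast
    then have yp: "y p < 0" unfolding y_def using c(3) False by simp
    have yT: "y u = m u * (1 - r u / r b)" if "u \<in> T" for u
      unfolding y_def cr[OF that] by (simp add: algebra_simps)
    have factor: "0 \<le> 1 - r u / r b" if "u \<in> T" for u using b(2)[OF that] False by simp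
    have yb: "y b = 0" using yT[OF b(1)] False by simp
    have ypos: "0 \<le> y u" if "u \<notin> insert p S" for u
    proof (cases "u \<in> T")
      case True
      then have "0 \<le> m u" using mS[of u] that by auto
      then show ?thesis unfolding yT[OF True] using factor[OF True] by simp
    next
      case False
      then show ?thesis unfolding y_def using cT[of u] mT[of u] that by simp
    qed
    have yneg: "y u \<le> 0" if "u \<in> S" for u
    proof -
      have "u \<in> T" "m u \<le> 0" using that ST mS[of u] by auto
      then show ?thesis using yT[of u] factor[of u] by (simp add: mult_nonpos_nonneg)
    qed
    show False
    proof (cases "b \<in> S")
      case True
      have "neg_part y \<subseteq> insert p (S - {b})"
      proof
        fix u assume "u \<in> neg_part y"
        then have "y u < 0" unfolding neg_part_def by simp
        then show "u \<in> insert p (S - {b})" using ypos[of u] yb by force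
      qed
      then show False using no_cone[OF y yp True] by simp
    next
      case False
      \<comment> \<open>If \<open>b\<close> is outside \<open>S\<close>, at most \<open>k\<close>
        positive coefficients remain, too few for \<open>neg_card\<close> applied to
        \<open>- y\<close>.\<close>
      define z where "z = (\<lambda>u. -1 * y u)"
      have z: "z \<in> L" unfolding z_def by (rule L_scale[OF y])
      have "z p \<noteq> 0" unfolding z_def using yp by simp
      then have "k + 1 \<le> card (neg_part z)" by (intro neg_card z nonzeroI)
      moreover have "neg_part z \<subseteq> T - S - {b}"
      proof
        fix u assume "u \<in> neg_part z"
        then have yu: "0 < y u" unfolding neg_part_def z_def by simp
        then have "u \<noteq> b" "u \<noteq> p" "u \<notin> S" using yb yp yneg[of u] by auto
        moreover have "u \<in> T"
        proof (rule ccontr)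
          assume "u \<notin> T"
          then have "y u = 0" unfolding y_def using cT[of u] mT[of u] \<open>u \<noteq> p\<close> by simp
          then show False using yu by simp
        qed
        ultimately show "u \<in> T - S - {b}" by blast
      qed
      then have "card (neg_part z) \<le> card (T - S - {b})" using T(4) by (intro card_mono) auto
      moreover have "card (T - S) = k + 1" using card_Diff_subset[OF finS ST] T(2) S(2) by simp
      then have "card (T - S - {b}) = k" using b(1) False by simp
      ultimately show False by simp
    qed
  qed
qed

lemma card_missing_cones:
  assumes "p \<in> V" "1 \<le> k" "2 * k + 2 \<le> card V"
  shows "card {S. S \<subseteq> V - {p} \<and> card S = k + 1 \<and> \<not> free_in L (insert p S) \<and>
      (\<forall>T. T \<subset> S \<longrightarrow> free_in L (insert p T))} = (card V - k - 3) choose (k - 1)"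
    (is "card ?C = _")
proof -
  have big: "k + 3 \<le> card V" using assms(2,3) by simp
  have "?C = {S \<in> nonfaces V L k. p \<notin> S} - nonfaces (V - {p}) (del p L) k"
  proof (intro equalityI subsetI)
    fix S assume "S \<in> ?C"
    then have S: "p \<notin> S" "S \<subseteq> V" "card S = k + 1" "\<not> free_in L (insert p S)"
      "\<And>T. T \<subset> S \<Longrightarrow> free_in L (insert p T)" by auto
    have "S \<in> nonfaces V L k" by (rule nonface_if_cone_missing[OF assms(1) S(1-3) big S(4,5)])
    moreover have "free_in (del p L) S"
      by (rule nonface_not_in_deletion_if_cone_missing[OF assms(1) S(1-3) big S(5)])
    then have "S \<notin> nonfaces (V - {p}) (del p L) k" unfolding nonfaces_def by simp
    ultimately show "S \<in> {S \<in> nonfaces V L k. p \<notin> S} - nonfaces (V - {p}) (del p L) k"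
      using S(1) by simp
  next
    fix S assume S: "S \<in> {S \<in> nonfaces V L k. p \<notin> S} - nonfaces (V - {p}) (del p L) k"
    then have SV: "S \<subseteq> V" "card S = k + 1" "p \<notin> S" "\<not> free_in L S" "S \<in> nonfaces V L k"
      unfolding nonfaces_def by auto
    then have "free_in (del p L) S" using S unfolding nonfaces_def by auto
    then have "free_in L (insert p T)" if "T \<subset> S" for T
      using free_in_cone_if[OF assms(2,1) SV(3,5) _ that] by blast
    moreover have "\<not> free_in L (insert p S)" using SV(4) free_in_mono[of L "insert p S" S] by blast
    ultimately show "S \<in> ?C" using SV by auto
  qed
  then show ?thesis using card_nonfaces_only_with[OF assms] by simp
qed

end

section \<open>The dimension of a sphere\<close>

lemma Euclidean_space_eq_subtopology:
  "Euclidean_space n = top_of_set {x. \<forall>i\<ge>n. x i = 0}"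
  by (simp add: Euclidean_space_def euclidean_product_topology)

text \<open>Openness allows stretching a point of \<open>W\<close> radially by a factor slightly
  above \<open>1\<close>, which leaves the unit sphere.\<close>

lemma sphere_not_open:
  assumes "openin (Euclidean_space n) W" "W \<noteq> {}"
    and sphere: "\<And>y. y \<in> W \<Longrightarrow> (\<Sum>i<n. (y i)\<^sup>2) = 1"
  shows False
proof -
  obtain y where y: "y \<in> W" using assms(2) by blast
  have y0: "y i = 0" if "n \<le> i" for i
    using openin_subset[OF assms(1)] y that by (auto simp: topspace_Euclidean_space)
  let ?g = "\<lambda>t i. t * y i :: real"
  have "continuous_map euclideanreal (Euclidean_space n) ?g"
    unfolding Euclidean_space_eq_subtopology
    by (auto simp: y0 continuous_map_in_subtopology intro!: continuous_on_coordinatewise_then_product continuous_intros)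
  from openin_continuous_map_preimage[OF this assms(1)]
  have "open {t. ?g t \<in> W}" by simp
  moreover have "1 \<in> {t. ?g t \<in> W}" using y by simp
  ultimately obtain e where e: "e > 0" "ball 1 e \<subseteq> {t. ?g t \<in> W}"
    by (meson openE)
  have "1 + e / 2 \<in> ball 1 e" using e by (simp add: dist_real_def)
  then have "?g (1 + e / 2) \<in> W" using e by blast
  from sphere[OF this] have "(1 + e / 2)\<^sup>2 * (\<Sum>i<n. (y i)\<^sup>2) = 1"
    by (simp add: power_mult_distrib sum_distrib_left)
  then have "(1 + e / 2)\<^sup>2 = 1" using sphere[OF y] by simp
  moreover have "(1 + e / 2)\<^sup>2 > 1" using e by (simp add: one_less_power)
  ultimately show False by simp
qed

text \<open>Softmax coordinates parametrise an open face of dimension \<open>m + 1\<close> by all of Euclidean space, so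
  by invariance of domain its image would be an open subset of the sphere's ambient space.\<close>

lemma sphere_face_card:
  assumes cplx: "abstract_complex \<Delta>"
    and homeo: "geometric_realization \<Delta> homeomorphic_space nsphere m"
    and face: "\<sigma> \<in> \<Delta>"
  shows "card \<sigma> \<noteq> m + 2"
proof
  assume card: "card \<sigma> = m + 2"
  define V where "V = vertex_set \<Delta>"
  define n where "n = m + 1"
  have finV: "finite V"
  proof -
    have "(\<lambda>v. {v}) ` V \<subseteq> \<Delta>" unfolding V_def vertex_set_def by auto
    then have "finite ((\<lambda>v. {v}) ` V)" using cplx finite_subset unfolding abstract_complex_def by blast
    then show ?thesis by (rule finite_imageD) simp
  qed
  have \<sigma>V: "\<sigma> \<subseteq> V"
    using cplx face unfolding V_def vertex_set_def abstract_complex_def by blast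
  have fin\<sigma>: "finite \<sigma>" using finite_subset[OF \<sigma>V finV] .
  have "card \<sigma> = card {..n}" using card unfolding n_def by simp
  then obtain idx where idx: "bij_betw idx \<sigma> {..n}"
    using finite_same_card_bij[OF fin\<sigma> finite_atMost] by blast
  define S where "S x = (\<Sum>i\<le>n. exp (x i))" for x :: "nat \<Rightarrow> real"
  have Spos: "0 < S x" for x unfolding S_def by (intro sum_pos) auto
  \<comment> \<open>Softmax of \<open>n + 1\<close> coordinates; points of
    \<open>Euclidean_space n\<close> have \<open>x n = 0\<close>, which removes the freedom of
    adding a constant and makes \<open>h\<close> injective.\<close>
  define h where "h x = (\<lambda>v\<in>V. if v \<in> \<sigma> then exp (x (idx v)) / S x else 0)" for x :: "nat \<Rightarrow> real"
  have contS: "continuous_on A S" for A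
    unfolding S_def by (intro continuous_intros continuous_on_subset[OF continuous_on_product_coordinates]) auto
  have cont: "continuous_map (Euclidean_space n) (geometric_realization \<Delta>) h"
    unfolding geometric_realization_def V_def[symmetric]
  proof (subst continuous_map_in_subtopology, intro conjI)
    show "continuous_map (Euclidean_space n) (powertop_real V) h"
      unfolding continuous_map_componentwise
    proof (intro conjI ballI)
      show "h ` topspace (Euclidean_space n) \<subseteq> extensional V" unfolding h_def by auto
      fix v assume "v \<in> V"
      then have "(\<lambda>x. h x v) = (\<lambda>x. if v \<in> \<sigma> then exp (x (idx v)) / S x else 0)"
        unfolding h_def by auto
      moreover have "continuous_on {x. \<forall>i\<ge>n. x i = 0} (\<lambda>x. exp (x (idx v)) / S x)"
        using Spos by (intro continuous_intros contS
            continuous_on_subset[OF continuous_on_product_coordinates]) (auto simp: less_imp_neq[symmetric])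
      ultimately show "continuous_map (Euclidean_space n) euclideanreal (\<lambda>x. h x v)"
        unfolding Euclidean_space_eq_subtopology by (cases "v \<in> \<sigma>") auto
    qed
    have "(\<forall>v\<in>V. 0 \<le> h x v) \<and> sum (h x) V = 1 \<and> {v \<in> V. h x v \<noteq> 0} \<in> \<Delta>" for x
    proof (intro conjI ballI)
      show "0 \<le> h x v" if "v \<in> V" for v using that Spos[of x] unfolding h_def by simp
      have "sum (h x) V = (\<Sum>v\<in>V. if v \<in> \<sigma> then exp (x (idx v)) / S x else 0)"
        unfolding h_def by (intro sum.cong) auto
      also have "\<dots> = (\<Sum>v\<in>\<sigma>. exp (x (idx v)) / S x)"
        using finV \<sigma>V by (simp add: sum.If_cases Int_absorb1)
      also have "\<dots> = (\<Sum>i\<le>n. exp (x i) / S x)" by (rule sum.reindex_bij_betw[OF idx])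
      also have "\<dots> = 1" unfolding sum_divide_distrib[symmetric] S_def[symmetric]
        using Spos[of x] by simp
      finally show "sum (h x) V = 1" .
      have "{v \<in> V. h x v \<noteq> 0} = \<sigma>" using \<sigma>V Spos[of x] unfolding h_def by auto
      then show "{v \<in> V. h x v \<noteq> 0} \<in> \<Delta>" using face by simp
    qed
    then show "h \<in> topspace (Euclidean_space n) \<rightarrow>
        {x. (\<forall>v\<in>V. 0 \<le> x v) \<and> sum x V = 1 \<and> {v \<in> V. x v \<noteq> 0} \<in> \<Delta>}"
      by blast
  qed
  have inj: "inj_on h (topspace (Euclidean_space n))"
  proof (rule inj_onI)
    fix x y assume x: "x \<in> topspace (Euclidean_space n)" and y: "y \<in> topspace (Euclidean_space n)"
      and hxy: "h x = h y"
    have eq: "exp (x i) / S x = exp (y i) / S y" if "i \<le> n" for i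
    proof -
      have "i \<in> idx ` \<sigma>" using idx that by (simp add: bij_betw_def)
      then obtain v where v: "v \<in> \<sigma>" "idx v = i" by blast
      moreover have "v \<in> V" using v \<sigma>V by blast
      ultimately show ?thesis using fun_cong[OF hxy, of v] by (simp add: h_def)
    qed
    have "x n = 0" "y n = 0" using x y by (auto simp: topspace_Euclidean_space)
    then have "S x = S y" using eq[of n] Spos[of x] Spos[of y] by (simp add: field_simps)
    then have "x i = y i" if "i \<le> n" for i using eq[OF that] Spos[of y] by simp
    moreover have "x i = y i" if "n < i" for i
      using x y that by (auto simp: topspace_Euclidean_space)
    ultimately show "x = y" by (metis ext not_le)
  qed
  obtain f g where fg: "homeomorphic_maps (geometric_realization \<Delta>) (nsphere m) f g"
    using homeo unfolding homeomorphic_space_def by blast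
  then have f: "continuous_map (geometric_realization \<Delta>) (nsphere m) f"
    "inj_on f (topspace (geometric_realization \<Delta>))"
    unfolding homeomorphic_maps_def by (auto intro: inj_on_inverseI[of _ g])
  have fh: "continuous_map (Euclidean_space n) (nsphere m) (f \<circ> h)"
    using continuous_map_compose[OF cont f(1)] .
  \<comment> \<open>\<open>nsphere m\<close> lies in \<open>Euclidean_space (m + 1)\<close>, which
    has the dimension of the open face.\<close>
  then have "continuous_map (Euclidean_space n) (Euclidean_space n) (f \<circ> h)"
    unfolding nsphere_def n_def by (simp add: continuous_map_in_subtopology)
  moreover have "inj_on (f \<circ> h) (topspace (Euclidean_space n))"
    using inj f(2) continuous_map_image_subset_topspace[OF cont]
    by (meson comp_inj_on inj_on_subset)
  ultimately have "openin (Euclidean_space n) ((f \<circ> h) ` topspace (Euclidean_space n))"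
    by (intro invariance_of_domain_Euclidean_space) auto
  then show False
  proof (rule sphere_not_open)
    show "(f \<circ> h) ` topspace (Euclidean_space n) \<noteq> {}"
      by (auto simp: topspace_Euclidean_space)
    fix y assume "y \<in> (f \<circ> h) ` topspace (Euclidean_space n)"
    then have "y \<in> topspace (nsphere m)"
      using continuous_map_image_subset_topspace[OF fh] by blast
    then show "(\<Sum>i<n. (y i)\<^sup>2) = 1" unfolding nsphere n_def by (simp add: lessThan_Suc_atMost)
  qed
qed

section \<open>Affine dependences of polytopes\<close>

definition affine_dependences :: "'b::real_vector set \<Rightarrow> ('b \<Rightarrow> real) set" where
  "affine_dependences V = {x. supp x \<subseteq> V \<and> sum x V = 0 \<and> (\<Sum>u\<in>V. x u *\<^sub>R u) = 0}"

lemma boundary_complex_iff: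
  "S \<in> boundary_complex P \<longleftrightarrow>
    (\<exists>F. F face_of P \<and> F \<noteq> P \<and> S = {x. x extreme_point_of P} \<inter> F)"
proof -
  have "{x. x extreme_point_of F} = {x. x extreme_point_of P} \<inter> F" if "F face_of P" for F
    using extreme_point_of_face[OF that] by auto
  then show ?thesis unfolding boundary_complex_def by (auto; metis)
qed

text \<open>Pair \<open>x\<close> with the slack of a hyperplane supporting the face on
  \<open>neg_part x\<close>: all terms are nonnegative and their sum is zero, so \<open>x\<close>
  vanishes off that face. Then \<open>x\<close> is nowhere positive, and having sum zero it is
  zero.\<close>

lemma free_in_if_face:
  fixes P :: "'b::euclidean_space set"
  assumes P: "polytope P" and V: "V = {x. x extreme_point_of P}"
    and faces: "\<And>T. T \<subseteq> S \<Longrightarrow> T \<in> boundary_complex P"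
  shows "free_in (affine_dependences V) S"
  unfolding free_in_def
proof (intro ballI impI)
  fix x assume x: "x \<in> affine_dependences V" and neg: "neg_part x \<subseteq> S"
  have finV: "finite V" unfolding V using P by (simp add: finite_polyhedron_extreme_points polytope_imp_polyhedron)
  have supp: "x u = 0" if "u \<notin> V" for u using x that unfolding affine_dependences_def supp_def by auto
  have sums: "sum x V = 0" "(\<Sum>u\<in>V. x u *\<^sub>R u) = 0" using x unfolding affine_dependences_def by auto
  obtain F where F: "F face_of P" "neg_part x = V \<inter> F"
    using faces[OF neg] unfolding boundary_complex_iff V by blast
  then have "F exposed_face_of P" using P by (simp add: exposed_face_of_polyhedron polytope_imp_polyhedron)
  then obtain a b where ab: "P \<subseteq> {y. a \<bullet> y \<le> b}" "F = P \<inter> {y. a \<bullet> y = b}"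
    unfolding exposed_face_of_def by blast
  have VP: "V \<subseteq> P" unfolding V extreme_point_of_def by auto
  have "(\<Sum>u\<in>V. x u * (b - a \<bullet> u)) = b * sum x V - a \<bullet> (\<Sum>u\<in>V. x u *\<^sub>R u)"
    by (simp add: sum_subtractf right_diff_distrib inner_sum_right sum_distrib_left mult.commute)
  then have "(\<Sum>u\<in>V. x u * (b - a \<bullet> u)) = 0" using sums by simp
  moreover have nonneg: "0 \<le> x u * (b - a \<bullet> u)" if "u \<in> V" for u
  proof (cases "u \<in> F")
    case True
    then show ?thesis using ab(2) by simp
  next
    case False
    then have "u \<notin> neg_part x" using F(2) by blast
    then have "0 \<le> x u" unfolding neg_part_def by simp
    moreover have "a \<bullet> u \<le> b" using ab(1) VP that by blast
    ultimately show ?thesis by simp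
  qed
  ultimately have zero: "x u * (b - a \<bullet> u) = 0" if "u \<in> V" for u
    using sum_nonneg_eq_0_iff[OF finV nonneg] that by simp
  have nonpos: "x u \<le> 0" for u
  proof (cases "u \<in> V \<and> u \<notin> F")
    case True
    then have "a \<bullet> u \<noteq> b" using ab(2) VP by blast
    then show ?thesis using zero[of u] True by simp
  next
    case False
    then show ?thesis using supp[of u] F(2) unfolding neg_part_def by force
  qed
  have "(\<Sum>u\<in>V. - x u) = 0" using sums(1) by (simp add: sum_negf)
  then have "x u = 0" if "u \<in> V" for u
    using sum_nonneg_eq_0_iff[of V "\<lambda>u. - x u"] finV nonpos that by simp
  then show "x = (\<lambda>_. 0)" using supp by (metis ext)
qed

text \<open>A common point of \<open>affine hull S\<close> and \<open>convex hull (V - S)\<close>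
  gives a dependence negative only in \<open>S\<close>, nonzero because its coefficients on
  \<open>S\<close> sum to \<open>-1\<close>. Disjointness of the two hulls makes
  \<open>convex hull S\<close> a face.\<close>

lemma face_if_free_in:
  fixes P :: "'b::euclidean_space set"
  assumes P: "polytope P" and V: "V = {x. x extreme_point_of P}"
    and S: "S \<subset> V" and free: "free_in (affine_dependences V) S"
  shows "S \<in> boundary_complex P"
proof -
  have finV: "finite V" unfolding V using P by (simp add: finite_polyhedron_extreme_points polytope_imp_polyhedron)
  have finS: "finite S" "finite (V - S)" using S finV finite_subset by auto
  have PV: "P = convex hull V"
    unfolding V using P by (intro Krein_Milman_Minkowski polytope_imp_compact polytope_imp_convex)
  have disj: "affine hull S \<inter> convex hull (V - S) = {}"
  proof (rule ccontr)
    assume "\<not> ?thesis"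
    then obtain z where "z \<in> affine hull S" "z \<in> convex hull (V - S)" by blast
    then obtain a b where a: "sum a S = 1" "(\<Sum>u\<in>S. a u *\<^sub>R u) = z"
      and b: "\<And>u. u \<in> V - S \<Longrightarrow> 0 \<le> b u" "sum b (V - S) = 1" "(\<Sum>u\<in>V - S. b u *\<^sub>R u) = z"
      unfolding affine_hull_finite[OF finS(1)] convex_hull_finite[OF finS(2)] by auto
    define x where "x u = (if u \<in> S then - a u else if u \<in> V then b u else 0)" for u
    have split: "sum g V = sum g (V - S) + sum g S" for g :: "'b \<Rightarrow> 'c::comm_monoid_add"
      using sum.subset_diff[of S V g] S finV by blast
    have "sum x V = 0"
      unfolding split using a(1) b(2) by (simp add: x_def sum_negf)
    moreover have "(\<Sum>u\<in>V. x u *\<^sub>R u) = 0"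
      unfolding split using a(2) b(3) by (simp add: x_def sum_negf)
    moreover have "supp x \<subseteq> V" unfolding supp_def x_def using S by auto
    ultimately have "x \<in> affine_dependences V" unfolding affine_dependences_def by blast
    moreover have "neg_part x \<subseteq> S"
    proof
      fix u assume "u \<in> neg_part x"
      then show "u \<in> S" using b(1)[of u] unfolding neg_part_def x_def by (auto split: if_splits)
    qed
    ultimately have "x = (\<lambda>_. 0)" using free unfolding free_in_def by blast
    then have "x u = 0" for u by simp
    then have "a u = 0" if "u \<in> S" for u using that unfolding x_def by (metis neg_equal_0_iff_equal)
    then show False using a(1) by simp
  qed
  have "V \<inter> convex hull S = S"
  proof
    show "S \<subseteq> V \<inter> convex hull S" using S hull_subset[of S convex] by blast
    show "V \<inter> convex hull S \<subseteq> S"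
    proof
      fix u assume u: "u \<in> V \<inter> convex hull S"
      then have "u \<in> affine hull S" using convex_hull_subset_affine_hull by blast
      then have "u \<notin> V - S" using disj hull_inc[of u "V - S" convex] by blast
      then show "u \<in> S" using u by blast
    qed
  qed
  moreover have "convex hull S face_of P"
    unfolding PV using face_of_convex_hulls[OF finV _ disj] S by blast
  moreover have "convex hull S \<noteq> P"
  proof
    assume "convex hull S = P"
    then have "V \<subseteq> convex hull S" unfolding PV using hull_subset[of V convex] by simp
    then show False using \<open>V \<inter> convex hull S = S\<close> S by blast
  qed
  ultimately show ?thesis unfolding boundary_complex_iff V[symmetric] by (metis)
qed

text \<open>Used to bound the dimension: a facet is a simplex of dimension
  \<open>aff_dim P - 1\<close>, and its vertex set belongs to the complex.\<close>

lemma simplicial_polytope_facet: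
  fixes P :: "'b::euclidean_space set"
  assumes "simplicial_polytope P" "0 < aff_dim P"
  obtains S where "S \<in> boundary_complex P" "finite S" "int (card S) = aff_dim P"
proof -
  obtain F where F: "F facet_of P"
    using polytope_facet_exists assms unfolding simplicial_polytope_def by blast
  then have face: "F face_of P" "F \<noteq> P" "aff_dim F = aff_dim P - 1" unfolding facet_of_def by auto
  then obtain d where d: "d simplex F" using assms(1) unfolding simplicial_polytope_def by blast
  then obtain C where C: "\<not> affine_dependent C" "int (card C) = d + 1" "F = convex hull C"
    unfolding simplex_def by blast
  have "{x. x extreme_point_of F} = C"
    unfolding C(3) using extreme_point_of_convex_hull_affine_independent[OF C(1)] by blast
  then have "C \<in> boundary_complex P" using face unfolding boundary_complex_def by blast
  moreover have "int (card C) = aff_dim P" using C(2) aff_dim_simplex[OF d] face(3) by simp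
  ultimately show ?thesis using that aff_independent_finite[OF C(1)] by blast
qed

text \<open>Two vertices rule out a one-point \<open>P\<close>, whose only vertex is not a proper
  face.\<close>

lemma vertex_set_boundary_complex:
  fixes P :: "'b::euclidean_space set"
  assumes "1 < card (vertex_set (boundary_complex P))"
  shows "vertex_set (boundary_complex P) = {x. x extreme_point_of P}"
proof
  have sub: "x extreme_point_of P" if "x \<in> vertex_set (boundary_complex P)" for x
    using that unfolding vertex_set_def boundary_complex_iff by blast
  then show "vertex_set (boundary_complex P) \<subseteq> {x. x extreme_point_of P}" by blast
  show "{x. x extreme_point_of P} \<subseteq> vertex_set (boundary_complex P)"
  proof
    fix x assume x: "x \<in> {x. x extreme_point_of P}"
    have "\<not> vertex_set (boundary_complex P) \<subseteq> {x}"
      using assms card_mono[of "{x}" "vertex_set (boundary_complex P)"] by auto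
    then obtain y where "y extreme_point_of P" "y \<noteq> x" using sub by blast
    then have "P \<noteq> {x}" unfolding extreme_point_of_def by blast
    moreover have "{x} face_of P" using x by (simp add: face_of_singleton)
    moreover have "{x} = {x. x extreme_point_of P} \<inter> {x}" using x by blast
    ultimately show "x \<in> vertex_set (boundary_complex P)"
      unfolding vertex_set_def boundary_complex_iff mem_Collect_eq by blast
  qed
qed

lemma balanced_affine_dependences:
  fixes P :: "'b::euclidean_space set"
  assumes P: "polytope P" and V: "V = {x. x extreme_point_of P}"
    and dim: "aff_dim P \<le> int (2 * k)"
    and neighborly: "\<And>S. S \<subseteq> V \<Longrightarrow> card S \<le> k \<Longrightarrow> S \<in> boundary_complex P"
  shows "balanced_dependences V (affine_dependences V) k"
proof
  show finV: "finite V" unfolding V using P by (simp add: finite_polyhedron_extreme_points polytope_imp_polyhedron)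
  show "(\<lambda>u. x u + y u) \<in> affine_dependences V"
    if "x \<in> affine_dependences V" "y \<in> affine_dependences V" for x y
  proof -
    have "supp (\<lambda>u. x u + y u) \<subseteq> supp x \<union> supp y" unfolding supp_def by auto
    then show ?thesis
      using that unfolding affine_dependences_def by (auto simp: sum.distrib scaleR_left_distrib)
  qed
  show "(\<lambda>u. c * x u) \<in> affine_dependences V" if "x \<in> affine_dependences V" for c x
  proof -
    have "(\<Sum>u\<in>V. (c * x u) *\<^sub>R u) = c *\<^sub>R (\<Sum>u\<in>V. x u *\<^sub>R u)" by (simp add: scaleR_sum_right)
    moreover have "(\<Sum>u\<in>V. c * x u) = c * sum x V" by (simp add: sum_distrib_left)
    ultimately show ?thesis using that unfolding affine_dependences_def supp_def by auto
  qed
  show "supp x \<subseteq> V" if "x \<in> affine_dependences V" for x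
    using that unfolding affine_dependences_def by blast
  show "k + 1 \<le> card (neg_part x)" if x: "x \<in> affine_dependences V" "x \<noteq> (\<lambda>_. 0)" for x
  proof (rule ccontr)
    assume less: "\<not> k + 1 \<le> card (neg_part x)"
    have "neg_part x \<subseteq> supp x" unfolding neg_part_def supp_def by auto
    then have sub: "neg_part x \<subseteq> V" using x(1) unfolding affine_dependences_def by blast
    have "free_in (affine_dependences V) (neg_part x)"
    proof (rule free_in_if_face[OF P V])
      fix T assume T: "T \<subseteq> neg_part x"
      have "card T \<le> card (neg_part x)" using T sub finV finite_subset by (intro card_mono) auto
      then show "T \<in> boundary_complex P" using neighborly[of T] less T sub by auto
    qed
    then show False using x unfolding free_in_def by blast
  qed
  show "\<exists>x\<in>affine_dependences V. x \<noteq> (\<lambda>_. 0) \<and> supp x \<subseteq> S"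
    if S: "S \<subseteq> V" "card S = 2 * k + 2" for S
  proof -
    have finS: "finite S" using S finV finite_subset by blast
    have "S \<subseteq> P" using S(1) unfolding V extreme_point_of_def by auto
    then have "affine_dependent S" using independent_card_le_aff_dim[of S P] dim S(2) by force
    then obtain U where U: "sum U S = 0" "\<exists>v\<in>S. U v \<noteq> 0" "(\<Sum>v\<in>S. U v *\<^sub>R v) = 0"
      unfolding affine_dependent_explicit_finite[OF finS] by blast
    define x where "x u = (if u \<in> S then U u else 0)" for u
    have "sum x V = sum x S" "(\<Sum>u\<in>V. x u *\<^sub>R u) = (\<Sum>u\<in>S. x u *\<^sub>R u)"
      using S(1) finV by (intro sum.mono_neutral_right; simp add: x_def)+
    moreover have "sum x S = 0" "(\<Sum>u\<in>S. x u *\<^sub>R u) = 0" using U by (simp_all add: x_def)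
    moreover have "supp x \<subseteq> S" unfolding supp_def x_def by auto
    ultimately have "x \<in> affine_dependences V" using S(1) unfolding affine_dependences_def by auto
    moreover obtain v where v: "v \<in> S" "U v \<noteq> 0" using U(2) by blast
    then have "x v \<noteq> 0" unfolding x_def by simp
    then have "x \<noteq> (\<lambda>_. 0)" by auto
    ultimately show ?thesis using \<open>supp x \<subseteq> S\<close> by blast
  qed
qed

section \<open>Transfer from the abstract sphere to the polytope\<close>

lemma missing_faces_lk:
  assumes cplx: "abstract_complex \<Delta>" and pairs: "\<And>u. u \<in> vertex_set \<Delta> \<Longrightarrow> {u, v} \<in> \<Delta>"
  shows "missing_faces k (lk v \<Delta>) = {S. S \<subseteq> vertex_set \<Delta> - {v} \<and> card S = k + 1 \<and>
    insert v S \<notin> \<Delta> \<and> (\<forall>T. T \<subset> S \<longrightarrow> insert v T \<in> \<Delta>)}"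
proof -
  have down: "S \<in> \<Delta>" if "T \<in> \<Delta>" "S \<subseteq> T" for S T using cplx that unfolding abstract_complex_def by blast
  have lk: "S \<in> lk v \<Delta> \<longleftrightarrow> insert v S \<in> \<Delta>" if "v \<notin> S" for S
    using that down[of "insert v S" S] unfolding lk_def by auto
  \<comment> \<open>Since every pair with \<open>v\<close> is a face, the link has all other
    vertices of the complex.\<close>
  have "vertex_set (lk v \<Delta>) = vertex_set \<Delta> - {v}"
    using pairs unfolding vertex_set_def lk_def by (auto simp: insert_commute)
  moreover have "S \<notin> lk v \<Delta> \<and> (\<forall>T. T \<subset> S \<longrightarrow> T \<in> lk v \<Delta>) \<longleftrightarrow>
      insert v S \<notin> \<Delta> \<and> (\<forall>T. T \<subset> S \<longrightarrow> insert v T \<in> \<Delta>)" if "S \<subseteq> vertex_set \<Delta> - {v}" for S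
  proof -
    have "v \<notin> T" if "T \<subseteq> S" for T using \<open>S \<subseteq> vertex_set \<Delta> - {v}\<close> that by blast
    then show ?thesis using lk by (metis order_refl psubset_imp_subset)
  qed
  ultimately show ?thesis unfolding missing_faces_def by auto
qed

lemma neighborlyD:
  assumes cplx: "abstract_complex \<Delta>" and "neighborly k \<Delta>" "finite (vertex_set \<Delta>)"
    and "k \<le> card (vertex_set \<Delta>)" "S \<subseteq> vertex_set \<Delta>" "card S \<le> k"
  shows "S \<in> \<Delta>"
proof -
  obtain T where T: "S \<subseteq> T" "T \<subseteq> vertex_set \<Delta>" "card T = k"
    using exists_subset_between[OF assms(6,4,5,3)] by blast
  then have "T \<in> \<Delta>" using assms(2) unfolding neighborly_def by blast
  then show ?thesis using cplx T(1) unfolding abstract_complex_def by blast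
qed

theorem theorem4p3:
  fixes k n :: nat and \<Delta> :: "'a set set" and v :: 'a
  assumes "k \<ge> 2"
    and "neighborly_sphere (2 * k) \<Delta>"
    and "card (vertex_set \<Delta>) = n"
    and "n \<ge> 2 * k + 2"
    and "v \<in> vertex_set \<Delta>"
    and "num_missing k (lk v \<Delta>) \<noteq> (n - k - 3) choose (k - 1)"
  shows "\<not> polytopal TYPE('b::euclidean_space) \<Delta>"
proof
  assume "polytopal TYPE('b) \<Delta>"
  then obtain P :: "'b set" and f where simp_P: "simplicial_polytope P"
    and f: "bij_betw f (vertex_set \<Delta>) (vertex_set (boundary_complex P))"
    and image: "(\<lambda>\<sigma>. f ` \<sigma>) ` \<Delta> = boundary_complex P"
    unfolding polytopal_def complex_isomorphic_def by blast
  define W V where "W = vertex_set \<Delta>" and "V = {x. x extreme_point_of P}"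
  have P: "polytope P" using simp_P unfolding simplicial_polytope_def by blast
  have cplx: "abstract_complex \<Delta>" and homeo: "geometric_realization \<Delta> homeomorphic_space nsphere (2 * k - 1)"
    and neigh: "neighborly k \<Delta>"
    using assms(2) unfolding neighborly_sphere_def simplicial_sphere_def by simp_all
  have cardW: "card W = n" and finW: "finite W"
    using assms(3,4) card_ge_0_finite[of W] unfolding W_def by simp_all
  have down: "S \<in> \<Delta>" if "T \<in> \<Delta>" "S \<subseteq> T" for S T
    using cplx that unfolding abstract_complex_def by blast
  have face_W: "S \<subseteq> W" if "S \<in> \<Delta>" for S using down[OF that] unfolding W_def vertex_set_def by blast
  have "card (vertex_set (boundary_complex P)) = n" using bij_betw_same_card[OF f] assms(3) by simp
  then have "vertex_set (boundary_complex P) = V"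
    unfolding V_def using assms(4) by (intro vertex_set_boundary_complex) simp
  then have fWV: "bij_betw f W V" using f unfolding W_def by simp
  then have inj: "inj_on f W" and fW: "f ` W = V" unfolding bij_betw_def by auto
  have cardV: "card V = n" using bij_betw_same_card[OF fWV] cardW by simp
  have image_face: "f ` S \<in> boundary_complex P" if "S \<in> \<Delta>" for S
    using that unfolding image[symmetric] by (rule imageI)
  have face_image: "\<exists>S\<in>\<Delta>. T = f ` S" if "T \<in> boundary_complex P" for T
    using that unfolding image[symmetric] by (simp add: image_iff)
  have face_iff: "S \<in> \<Delta> \<longleftrightarrow> f ` S \<in> boundary_complex P" if "S \<subseteq> W" for S
  proof
    assume "f ` S \<in> boundary_complex P"
    then obtain T where T: "T \<in> \<Delta>" "f ` S = f ` T" using face_image by blast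
    then have "S = T" using inj_on_image_eq_iff[OF inj that face_W[OF T(1)]] by blast
    then show "S \<in> \<Delta>" using T by blast
  qed (rule image_face)
  have Pdown: "S \<in> boundary_complex P" if T: "T \<in> boundary_complex P" "S \<subseteq> T" for S T
  proof -
    obtain T' where T': "T' \<in> \<Delta>" "T = f ` T'" using face_image[OF T(1)] by blast
    then have "S \<subseteq> f ` T'" using T(2) by simp
    then obtain S' where "S' \<subseteq> T'" "S = f ` S'" by (rule subset_imageE)
    then show ?thesis using image_face[OF down[OF T'(1)]] by simp
  qed
  \<comment> \<open>A facet of a polytope of larger dimension would give a face of
    \<open>\<Delta>\<close> with \<open>2 * k + 1\<close> vertices, too many for a sphere of
    dimension \<open>2 * k - 1\<close>.\<close>
  have dim: "aff_dim P \<le> int (2 * k)"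
  proof (rule ccontr)
    assume big: "\<not> aff_dim P \<le> int (2 * k)"
    then have "0 < aff_dim P" by linarith
    then obtain C where C: "C \<in> boundary_complex P" "finite C" "int (card C) = aff_dim P"
      using simplicial_polytope_facet[OF simp_P] by blast
    then have "2 * k + 1 \<le> card C" using big by linarith
    then obtain S where S: "S \<subseteq> C" "card S = 2 * k + 1" by (meson obtain_subset_with_card_n)
    then have "S \<in> boundary_complex P" using Pdown C by blast
    then obtain S' where S': "S' \<in> \<Delta>" "S = f ` S'" using face_image by blast
    then have "card S' = 2 * k - 1 + 2"
      using card_image[OF inj_on_subset[OF inj face_W[OF S'(1)]]] S(2) assms(1) by simp
    then show False using sphere_face_card[OF cplx homeo S'(1)] by blast
  qed
  have small: "S \<in> \<Delta>" if "S \<subseteq> W" "card S \<le> k" for S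
    using neighborlyD[OF cplx neigh] finW cardW assms(4) that unfolding W_def by simp
  interpret balanced_dependences V "affine_dependences V" k
  proof (rule balanced_affine_dependences[OF P V_def dim])
    fix S assume S: "S \<subseteq> V" "card S \<le> k"
    then have "S \<subseteq> f ` W" using fW by simp
    then obtain S' where S': "S' \<subseteq> W" "S = f ` S'" by (rule subset_imageE)
    then have "card S' \<le> k" using S(2) card_image[OF inj_on_subset[OF inj]] by simp
    then show "S \<in> boundary_complex P" using small S' face_iff by blast
  qed
  have face_free: "S \<in> \<Delta> \<longleftrightarrow> free_in (affine_dependences V) (f ` S)" if "S \<subset> W" for S
  proof
    assume "S \<in> \<Delta>"
    then show "free_in (affine_dependences V) (f ` S)"
      by (rule free_in_if_face[OF P V_def Pdown[OF image_face]])
  next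
    assume free: "free_in (affine_dependences V) (f ` S)"
    have "f ` S \<subset> V" unfolding fW[symmetric] using inj that by (rule image_strict_mono)
    then have "f ` S \<in> boundary_complex P" by (rule face_if_free_in[OF P V_def _ free])
    moreover have "S \<subseteq> W" using that by blast
    ultimately show "S \<in> \<Delta>" using face_iff by simp
  qed
  have vW: "v \<in> W" using assms(5) unfolding W_def .
  let ?C = "{S. S \<subseteq> V - {f v} \<and> card S = k + 1 \<and>
      \<not> free_in (affine_dependences V) (insert (f v) S) \<and>
      (\<forall>T. T \<subset> S \<longrightarrow> free_in (affine_dependences V) (insert (f v) T))}"
  \<comment> \<open>Pairs of vertices are faces because \<open>k\<close> is at least
    \<open>2\<close>.\<close>
  have "{u, v} \<in> \<Delta>" if "u \<in> W" for u
    using that vW assms(1) by (intro small) (auto simp: card_insert_if)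
  then have missing: "missing_faces k (lk v \<Delta>) = {S. S \<subseteq> W - {v} \<and> card S = k + 1 \<and>
      insert v S \<notin> \<Delta> \<and> (\<forall>T. T \<subset> S \<longrightarrow> insert v T \<in> \<Delta>)}"
    unfolding W_def by (rule missing_faces_lk[OF cplx])
  have cone: "insert v S \<in> \<Delta> \<longleftrightarrow> free_in (affine_dependences V) (insert (f v) (f ` S))"
    if "S \<subseteq> W" "finite S" "card S \<le> k + 1" for S
  proof -
    have "card (insert v S) \<le> k + 2" using that by (simp add: card_insert_if)
    \<comment> \<open>\<open>k + 2 < 2 * k + 2 <= n\<close>, so the cones in question are proper
      subsets of \<open>W\<close> and \<open>face_free\<close> applies.\<close>
    then have "insert v S \<noteq> W" using cardW assms(1,4) by auto
    then have "insert v S \<subset> W" using that(1) vW by blast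
    then show ?thesis using face_free[of "insert v S"] by simp
  qed
  have image_C: "f ` S \<in> ?C \<longleftrightarrow> S \<in> missing_faces k (lk v \<Delta>)" if "S \<subseteq> W - {v}" for S
  proof (cases "card S = k + 1")
    case True
    have SW: "S \<subseteq> W" "finite S" using that finW finite_subset by auto
    have injS: "inj_on f S" using inj SW(1) by (rule inj_on_subset)
    have "f ` S \<subseteq> f ` (W - {v})" using that by blast
    also have "\<dots> = V - {f v}" using inj_on_image_set_diff[OF inj, of W "{v}"] vW fW by simp
    finally have sub: "f ` S \<subseteq> V - {f v}" .
    have coneT: "insert v T \<in> \<Delta> \<longleftrightarrow> free_in (affine_dependences V) (insert (f v) (f ` T))"
      if "T \<subseteq> S" for T
      using that SW True card_mono[OF SW(2) that] by (intro cone) (auto intro: finite_subset)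
    have "(\<forall>T. T \<subset> f ` S \<longrightarrow> free_in (affine_dependences V) (insert (f v) T)) \<longleftrightarrow>
        (\<forall>T. T \<subset> S \<longrightarrow> insert v T \<in> \<Delta>)" (is "?L \<longleftrightarrow> ?R")
    proof
      assume L: ?L
      show ?R
      proof (intro allI impI)
        fix T assume T: "T \<subset> S"
        then have "f ` T \<subset> f ` S" by (rule image_strict_mono[OF injS])
        then show "insert v T \<in> \<Delta>" using L coneT[of T] T by blast
      qed
    next
      assume R: ?R
      show ?L
      proof (intro allI impI)
        fix T assume T: "T \<subset> f ` S"
        then have "T \<subseteq> f ` S" by blast
        then obtain T' where T': "T' \<subseteq> S" "T = f ` T'" by (rule subset_imageE)
        then have "T' \<subset> S" using T by blast
        then show "free_in (affine_dependences V) (insert (f v) T)" using R coneT[of T'] T' by blast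
      qed
    qed
    then show ?thesis
      unfolding missing using coneT[of S] sub that True card_image[OF injS] by simp
  next
    case False
    have "inj_on f S" using that by (intro inj_on_subset[OF inj]) blast
    then show ?thesis unfolding missing using False by (simp add: card_image)
  qed
  \<comment> \<open>\<open>f\<close> carries the missing faces of the link to the sets counted by
    \<open>card_missing_cones\<close>.\<close>
  have "?C = (`) f ` missing_faces k (lk v \<Delta>)"
  proof (intro equalityI subsetI)
    fix S assume S: "S \<in> ?C"
    then have "S \<subseteq> f ` (W - {v})" using inj_on_image_set_diff[OF inj, of W "{v}"] vW fW by simp
    then obtain S' where S': "S' \<subseteq> W - {v}" "S = f ` S'" by (rule subset_imageE)
    then have "S' \<in> missing_faces k (lk v \<Delta>)" using image_C[OF S'(1)] S by (simp only:)
    then show "S \<in> (`) f ` missing_faces k (lk v \<Delta>)" unfolding S'(2) by (rule imageI)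
  next
    fix S assume "S \<in> (`) f ` missing_faces k (lk v \<Delta>)"
    then obtain S' where S': "S' \<in> missing_faces k (lk v \<Delta>)" "S = f ` S'" by blast
    then have "S' \<subseteq> W - {v}" unfolding missing by blast
    then show "S \<in> ?C" using image_C[of S'] S' by (simp only:)
  qed
  moreover have "inj_on ((`) f) (missing_faces k (lk v \<Delta>))"
    using inj_on_image_Pow[OF inj] by (rule inj_on_subset) (auto simp: missing)
  ultimately have "num_missing k (lk v \<Delta>) = card ?C"
    unfolding num_missing_def by (simp only: card_image)
  also have "\<dots> = (n - k - 3) choose (k - 1)"
    using card_missing_cones[of "f v"] vW fW assms(1,4) cardV by auto
  finally show False using assms(6) by contradiction
qed

end
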